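(* Let $\mu,\nu\in\mathbb{R}$ with $\mu\in(-\frac32,-\frac12)$ and $|\nu|\in(|\mu+1|,\mu+2)$. Then, apart from the branch point $z=0$, the Lommel function $s_{\mu,\nu}(z)$ possesses only real zeros. These zeros are simple, the non-negative ones (other than the branch point $z=0$) are all contained in the intervals $\left(\frac{(2k+1)\pi}{2},\frac{(2k+3)\pi}{2}\right)$, $k=0,1,2,\ldots$, and each of these intervals contains exactly one zero.
   Context: When neither $\mu+\nu$ nor $\mu-\nu$ is an odd negative integer, the Lommel function is $$s_{\mu,\nu}(z)=z^{\mu+1}\sum_{k=0}^\infty \frac{(-1)^k z^{2k}}{\prod_{j=0}^{k}\left((\mu+2j+1)^2-\nu^2\right)}=\frac{z^{\mu+1}}{(\mu+1)^2-\nu^2}\,{}_1F_2\left(1;\tfrac{\mu-\nu+3}{2},\tfrac{\mu+\nu+3}{2};-\tfrac{z^2}{4}\right),$$ a solution of $z^2y''+zy'+(z^2-\nu^2)y=z^{\mu+1}$. The function $z^{-\mu-1}s_{\mu,\nu}(z)$ is an even entire function of $z$, so the zeros of $s_{\mu,\nu}$ in $\mathbb{C}\setminus\{0\}$ (and their multiplicities) do not depend on the branch chosen for $z^{\mu+1}$. *)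

theory Defs
  imports "HOL-Complex_Analysis.Complex_Analysis"
begin

text \<open>The even entire function \<open>z\<^bsup>-\<mu>-1\<^esup> s\<^bsub>\<mu>,\<nu>\<^esub>(z)\<close>. The parameters are
  meant to be such that neither \<open>\<mu> + \<nu>\<close> nor \<open>\<mu> - \<nu>\<close> is an odd negative integer, i.e. no
  factor of the denominators vanishes.\<close>

definition lommel_series :: "complex \<Rightarrow> complex \<Rightarrow> complex \<Rightarrow> complex" where
  "lommel_series \<mu> \<nu> z =
     (\<Sum>k. (- 1) ^ k * z ^ (2 * k) / (\<Prod>j\<le>k. (\<mu> + 2 * of_nat j + 1)\<^sup>2 - \<nu>\<^sup>2))"

definition lommel_s :: "complex \<Rightarrow> complex \<Rightarrow> complex \<Rightarrow> complex" where
  "lommel_s \<mu> \<nu> z = z powr (\<mu> + 1) * lommel_series \<mu> \<nu> z"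

text \<open>The principal branch \<open>lommel_s\<close> is in general discontinuous across the negative real axis,
  so it cannot be used to speak of the multiplicity of a negative zero. For this
  purpose the power \<open>z\<^bsup>\<mu>+1\<^esup>\<close> is also formed from an arbitrary holomorphic branch
  of the logarithm; every \<open>z \<noteq> 0\<close> lies in the domain of such a branch.\<close>

definition log_branch_on :: "complex set \<Rightarrow> (complex \<Rightarrow> complex) \<Rightarrow> bool" where
  "log_branch_on S L \<longleftrightarrow> open S \<and> L holomorphic_on S \<and> (\<forall>z\<in>S. exp (L z) = z)"

definition lommel_s_branch ::
  "(complex \<Rightarrow> complex) \<Rightarrow> complex \<Rightarrow> complex \<Rightarrow> complex \<Rightarrow> complex" where
  "lommel_s_branch L \<mu> \<nu> z = exp ((\<mu> + 1) * L z) * lommel_series \<mu> \<nu> z"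

lemma log_branch_on_Ln: "log_branch_on (- \<real>\<^sub>\<le>\<^sub>0) Ln"
proof -
  have "exp (Ln z) = z" if "z \<in> - \<real>\<^sub>\<le>\<^sub>0" for z :: complex
    using that by (intro exp_Ln) auto
  moreover have "open (- \<real>\<^sub>\<le>\<^sub>0 :: complex set)"
    by (rule open_Compl) simp
  moreover have "Ln holomorphic_on - \<real>\<^sub>\<le>\<^sub>0"
    by (rule holomorphic_on_Ln) blast
  ultimately show ?thesis
    unfolding log_branch_on_def by blast
qed

lemma lommel_s_branch_Ln: "z \<noteq> 0 \<Longrightarrow> lommel_s_branch Ln \<mu> \<nu> z = lommel_s \<mu> \<nu> z"
  by (simp add: lommel_s_branch_def lommel_s_def powr_def)

lemma ex_log_branch_on:
  assumes "z \<noteq> 0"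
  shows "\<exists>S L. z \<in> S \<and> log_branch_on S L"
proof -
  let ?S = "(\<lambda>w. w / z) -` (- \<real>\<^sub>\<le>\<^sub>0)"
  let ?L = "\<lambda>w. Ln (w / z) + Ln z"
  have "continuous_on UNIV (\<lambda>w. w / z)"
    using assms by (intro continuous_intros) simp
  then have "open ?S"
    by (intro open_vimage) (simp_all add: open_Compl)
  moreover have "?L holomorphic_on ?S"
    using assms by (intro holomorphic_intros) simp_all
  moreover have "exp (?L w) = w" if "w \<in> ?S" for w
  proof -
    have "w / z \<noteq> 0" using that by force
    then show ?thesis using assms by (simp add: exp_add)
  qed
  ultimately have "log_branch_on ?S ?L"
    unfolding log_branch_on_def by blast
  moreover have "z \<in> ?S" using assms by simp
  ultimately show ?thesis by (intro exI conjI)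
qed

end

theory Submission
  imports Defs "HOL-Computational_Algebra.Fundamental_Theorem_Algebra"
begin

text \<open>
  Put \<open>\<alpha> = (\<mu> + 1 - \<bar>\<nu>\<bar>) / 2\<close> and \<open>\<beta> = (\<mu> + 1 + \<bar>\<nu>\<bar>) / 2\<close>. The factors of the denominators are
  \<open>4 (\<alpha> + j) (\<beta> + j)\<close>, and the hypotheses imply \<open>-1/2 < \<alpha> < 0 < \<beta>\<close> and \<open>\<alpha> + \<beta> < 1/2\<close>.
  The proof writes \<open>z\<^bsup>-\<mu>-1\<^esup> s\<^bsub>\<mu>,\<nu>\<^esub>(z)\<close>, up to a constant factor, as the cosine transform
  \<open>C(z) = \<integral>\<^sub>0\<^sup>1 g(t) cos (z t) dt\<close> of a positive increasing weight \<open>g\<close>; the zeros of such a transform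
  are located by a theorem of Polya.

  \<^bold>\<open>The weight.\<close> The coefficient of \<open>(-1)\<^sup>k z\<^bsup>2k\<^esup>\<close> in the Lommel series, multiplied by \<open>(2k)!\<close>, is a
  sequence \<open>M\<^sub>k\<close> with \<open>M\<^bsub>k+1\<^esub> / M\<^sub>k = (k + 1/2) (k + 1) / ((k + 1 + \<alpha>) (k + 1 + \<beta>))\<close>. Up to a constant
  factor these are the even moments of \<open>g(t) = (1 - t\<^sup>2)\<^bsup>s-1\<^esup> F(1 - t\<^sup>2)\<close>, where \<open>s = \<alpha> + \<beta> + 1/2\<close>
  and \<open>F\<close> is the hypergeometric function with parameters \<open>\<alpha>, \<beta>; s\<close>. Termwise integration
  turns the moments into hypergeometric series at 1, and their quotients are given by
  a contiguous relation that follows by telescoping (\<open>gauss_sum_shift\<close>). As \<open>-1 < \<alpha> < 0 < \<beta>\<close>, every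
  coefficient of \<open>F\<close> except the constant one is negative, so \<open>F(1 - t\<^sup>2)\<close> increases with \<open>t\<close>, and
  so does \<open>(1 - t\<^sup>2)\<^bsup>s-1\<^esup>\<close> because \<open>s < 1\<close>.

  \<^bold>\<open>Polya's theorem.\<close> Let \<open>E(z) = \<integral>\<^sub>0\<^sup>1 g(t) exp (i z t) dt\<close>, so that \<open>2 C(z) = E(z) + E(-z)\<close>.
  Cutting \<open>[0, 1)\<close> into \<open>n\<close> equal cells exhibits \<open>E(z)\<close> as a limit of \<open>P(w)\<close>, \<open>w = exp (i z / n)\<close>,
  where \<open>P\<close> is a polynomial of degree \<open>n - 1\<close> whose coefficients, the masses of the cells, increase.
  Two inequalities for such polynomials pass to the limit for \<open>Im z \<le> 0\<close>:

  \<^item> By Enestroem and Kakeya all zeros of \<open>P\<close> lie in the closed unit disc, and therefore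
    \<open>\<bar>w\<^sup>d P(1/w)\<bar> \<le> \<bar>P(w)\<bar>\<close> for \<open>\<bar>w\<bar> \<ge> 1\<close>, \<open>d\<close> being the degree. In the limit
    \<open>exp (- Im z) \<bar>E(-z)\<bar> \<le> \<bar>E(z)\<bar>\<close> (\<open>norm_exp_transform_reflect_le\<close>).
  \<^item> Abel summation yields \<open>Re (i z exp (- i z) E(z)) \<ge> 0\<close> (\<open>Re_exp_transform_nonneg\<close>). Applied
    to \<open>g\<close> minus a constant it becomes strict for \<open>Im z < 0\<close>, and applied to \<open>g\<close> minus a small
    multiple of \<open>t\<^sup>2\<close> it becomes strict on the positive real axis.

  The second inequality shows \<open>E(z) \<noteq> 0\<close> for \<open>Im z < 0\<close>; with the first one, \<open>E(z) = - E(-z)\<close> is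
  then impossible, so \<open>C\<close> has real zeros only. At a zero \<open>x > 0\<close> of \<open>C\<close> one has \<open>E(x) = i S\<close> with \<open>S\<close>
  real. The first inequality is an equality on the real axis, and differentiating it in the
  imaginary direction yields \<open>- S C'(x) \<ge> S\<^sup>2 / 2\<close>. The second one, in its strict form, reads
  \<open>S cos x < 0\<close>. Hence \<open>C'(x) cos x > 0\<close>: zeros are simple, and all zeros between two consecutive odd
  multiples of \<open>\<pi>/2\<close> cross the axis in the same direction, so that there is at most one. At the odd
  multiples of \<open>\<pi>/2\<close> themselves the second inequality gives \<open>C(x) sin x > 0\<close>, which provides the
  sign changes. Between 0 and \<open>\<pi>/2\<close> a zero would be an upward crossing, but \<open>C(0) > 0\<close>.
\<close>

section \<open>Polynomials with increasing coefficients\<close>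

text \<open>Summation by parts. When \<open>b\<close> decreases, the right-hand side is a combination of the numbers
  \<open>1 - v ^ j\<close> with nonnegative coefficients, and each of these has nonnegative real part on the closed
  unit disc.\<close>

lemma abel_decreasing_coeffs:
  fixes b :: "nat \<Rightarrow> real" and v :: complex
  shows "(1 - v) * (\<Sum>j\<le>d. of_real (b j) * v ^ j) =
    (\<Sum>j<d. of_real (b j - b (Suc j)) * (1 - v ^ Suc j)) + of_real (b d) * (1 - v ^ Suc d)"
  by (induction d) (simp_all add: algebra_simps)

text \<open>The term \<open>(1 - norm v) * b 0\<close> serves two purposes: it is positive inside the disc, which gives the
  theorem of Enestroem and Kakeya, and it vanishes harmlessly on the circle, where only the sign of
  the real part is used.\<close>

lemma Re_decreasing_coeffs_ge:
  fixes b :: "nat \<Rightarrow> real" and v :: complex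
  assumes dec: "\<And>j. j < d \<Longrightarrow> b (Suc j) \<le> b j" and "0 \<le> b d" and v: "norm v \<le> 1"
  shows "(1 - norm v) * b 0 \<le> Re ((1 - v) * (\<Sum>j\<le>d. of_real (b j) * v ^ j))"
proof -
  \<comment> \<open>The lower bound is the same for all powers, so the coefficients telescope to \<open>b 0\<close>.\<close>
  have pow: "1 - norm v \<le> Re (1 - v ^ Suc j)" for j
  proof -
    have "Re (v ^ Suc j) \<le> norm v ^ Suc j"
      using complex_Re_le_cmod[of "v ^ Suc j"] by (simp add: norm_mult norm_power)
    also have "\<dots> \<le> norm v"
      using v power_decreasing[of 1 "Suc j" "norm v"] by simp
    finally show ?thesis by simp
  qed
  have "(1 - norm v) * b 0 = (\<Sum>j<d. (b j - b (Suc j)) * (1 - norm v)) + b d * (1 - norm v)"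
    unfolding sum_distrib_right[symmetric] sum_lessThan_telescope' by (simp add: algebra_simps)
  also have "\<dots> \<le> (\<Sum>j<d. (b j - b (Suc j)) * Re (1 - v ^ Suc j)) + b d * Re (1 - v ^ Suc d)"
    using dec \<open>0 \<le> b d\<close> pow by (intro add_mono sum_mono mult_left_mono) auto
  also have "\<dots> = Re ((1 - v) * (\<Sum>j\<le>d. of_real (b j) * v ^ j))"
    unfolding abel_decreasing_coeffs by simp
  finally show ?thesis .
qed

lemma reversed_poly_sum:
  fixes w :: complex and a :: "nat \<Rightarrow> real" and d :: nat
  assumes "w \<noteq> 0"
  shows "(\<Sum>k\<le>d. of_real (a k) * w ^ k) = w ^ d * (\<Sum>j\<le>d. of_real (a (d - j)) * inverse w ^ j)"
proof -
  have "(\<Sum>k\<le>d. of_real (a k) * w ^ k) = (\<Sum>j\<le>d. of_real (a (d - j)) * w ^ (d - j))"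
    by (rule sum.reindex_bij_witness[of _ "\<lambda>j. d - j" "\<lambda>j. d - j"]) auto
  also have "\<dots> = w ^ d * (\<Sum>j\<le>d. of_real (a (d - j)) * inverse w ^ j)"
    using assms unfolding sum_distrib_left
    by (intro sum.cong) (auto simp: power_diff field_simps)
  finally show ?thesis .
qed

text \<open>Outside the closed unit disc the reversed polynomial is evaluated at the point \<open>inverse w\<close> of the
  open disc, and its coefficients decrease.\<close>

proposition enestroem_kakeya:
  fixes a :: "nat \<Rightarrow> real" and w :: complex
  assumes inc: "\<And>j. j < d \<Longrightarrow> a j \<le> a (Suc j)" and "0 \<le> a 0" and "0 < a d"
    and zero: "(\<Sum>k\<le>d. of_real (a k) * w ^ k) = 0"
  shows "norm w \<le> 1"
proof (rule ccontr)
  assume "\<not> norm w \<le> 1"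
  then have w: "norm w > 1" "w \<noteq> 0" by auto
  let ?v = "inverse w"
  have v: "norm ?v < 1" using w by (simp add: norm_inverse inverse_less_1_iff)
  have dec: "a (d - Suc j) \<le> a (d - j)" if "j < d" for j
    using inc[of "d - Suc j"] that by (simp add: Suc_diff_Suc)
  have "(1 - norm ?v) * a (d - 0) \<le> Re ((1 - ?v) * (\<Sum>j\<le>d. of_real (a (d - j)) * ?v ^ j))"
    using dec \<open>0 \<le> a 0\<close> v by (intro Re_decreasing_coeffs_ge) auto
  also have "(\<Sum>j\<le>d. of_real (a (d - j)) * ?v ^ j) = 0"
    using zero w reversed_poly_sum[of w a d] by simp
  finally show False using v \<open>0 < a d\<close> by (simp add: mult_le_0_iff)
qed

text \<open>Factor by factor this is the identity
  \<open>\<bar>cnj w - x\<bar>\<^sup>2 - \<bar>1 - w x\<bar>\<^sup>2 = (\<bar>w\<bar>\<^sup>2 - 1) (1 - \<bar>x\<bar>\<^sup>2)\<close>.\<close>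

lemma norm_reciprocal_factors_le:
  fixes w :: complex
  assumes "\<forall>x\<in>#A. norm x \<le> 1" "norm w \<ge> 1"
  shows "norm (\<Prod>x\<in>#A. 1 - w * x) \<le> norm (\<Prod>x\<in>#A. cnj w - x)"
  using assms(1)
proof (induction A)
  case (add x A)
  have "(norm (1 - w * x))\<^sup>2 \<le> (norm (cnj w - x))\<^sup>2"
  proof -
    have "(norm (cnj w - x))\<^sup>2 - (norm (1 - w * x))\<^sup>2 = ((norm w)\<^sup>2 - 1) * (1 - (norm x)\<^sup>2)"
      unfolding cmod_power2 by (simp add: algebra_simps power2_eq_square)
    also have "\<dots> \<ge> 0"
      using add.prems assms(2) by (intro mult_nonneg_nonneg) (auto simp: abs_square_le_1)
    finally show ?thesis by simp
  qed
  then have "norm (1 - w * x) \<le> norm (cnj w - x)" by (rule power2_le_imp_le) simp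
  then show ?case using add by (auto simp: norm_mult intro!: mult_mono)
qed simp

lemma reciprocal_factors:
  fixes w :: complex
  assumes "w \<noteq> 0"
  shows "w ^ size A * (\<Prod>x\<in>#A. inverse w - x) = (\<Prod>x\<in>#A. 1 - w * x)"
  by (induction A) (use assms in \<open>auto simp: algebra_simps\<close>)

text \<open>A polynomial with all its zeros in the closed unit disc dominates its reciprocal polynomial outside
  the disc. The coefficients are real, so the value at \<open>w\<close> may be replaced by the one at \<open>cnj w\<close>,
  which is the form in which the factors can be compared.\<close>

proposition norm_reciprocal_poly_le:
  fixes a :: "nat \<Rightarrow> real" and w :: complex
  assumes inc: "\<And>j. j < d \<Longrightarrow> a j \<le> a (Suc j)" and "0 \<le> a 0" and w: "norm w \<ge> 1"
  shows "norm (w ^ d * (\<Sum>k\<le>d. of_real (a k) * inverse w ^ k)) \<le> norm (\<Sum>k\<le>d. of_real (a k) * w ^ k)"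
proof -
  have le: "a i \<le> a j" if "i \<le> j" "j \<le> d" for i j
    using that
  proof (induction j)
    case (Suc j)
    then show ?case using inc[of j] by (auto simp: le_Suc_eq)
  qed simp
  show ?thesis
  proof (cases "a d = 0")
    case True
    have "a i = 0" if "i \<le> d" for i
      using le[of 0 i] le[of i d] that True \<open>0 \<le> a 0\<close> by simp
    then show ?thesis by simp
  next
    case False
    with le[of 0 d] \<open>0 \<le> a 0\<close> have pos: "0 < a d" by simp
    define p :: "complex poly" where "p = (\<Sum>k\<le>d. monom (of_real (a k)) k)"
    have poly_p: "poly p x = (\<Sum>k\<le>d. of_real (a k) * x ^ k)" for x
      by (simp add: p_def poly_sum poly_monom)
    have coeff_p: "coeff p k = (if k \<le> d then of_real (a k) else 0)" for k
      by (simp add: p_def coeff_sum)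
    have deg: "degree p = d"
      using False by (intro antisym degree_le le_degree) (auto simp: coeff_p)
    have "p \<noteq> 0" using coeff_p[of d] False by auto
    then obtain A where A: "size A = d" and p: "p = smult (lead_coeff p) (\<Prod>x\<in>#A. [:-x, 1:])"
      using alg_closed_imp_factorization[OF \<open>p \<noteq> 0\<close>] unfolding deg by blast
    define c where "c = lead_coeff p"
    have poly_A: "poly p x = c * (\<Prod>y\<in>#A. x - y)" for x
      using arg_cong[OF p, of "\<lambda>q. poly q x"]
      by (simp add: poly_prod_mset image_mset.compositionality o_def flip: c_def)
    have roots: "\<forall>x\<in>#A. norm x \<le> 1"
    proof
      fix x assume "x \<in># A"
      then have "poly p x = 0" unfolding poly_A by auto
      then show "norm x \<le> 1"
        using enestroem_kakeya[of d a x] inc \<open>0 \<le> a 0\<close> pos by (simp add: poly_p)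
    qed
    have "w \<noteq> 0" using w by auto
    have "w ^ d * poly p (inverse w) = c * (\<Prod>x\<in>#A. 1 - w * x)"
      using reciprocal_factors[OF \<open>w \<noteq> 0\<close>, of A] A unfolding poly_A by (simp add: mult.left_commute)
    then have "norm (w ^ d * poly p (inverse w)) \<le> norm c * norm (\<Prod>x\<in>#A. cnj w - x)"
      using norm_reciprocal_factors_le[OF roots w] by (simp add: norm_mult mult_left_mono)
    also have "\<dots> = norm (poly p (cnj w))" unfolding poly_A by (simp add: norm_mult)
    also have "poly p (cnj w) = cnj (poly p w)" unfolding poly_p by simp
    finally show ?thesis unfolding poly_p complex_mod_cnj .
  qed
qed

section \<open>Exponential transforms on the unit interval as limits of polynomials\<close>

text \<open>The right endpoint is left out because the weight of the Lommel function is singular there.\<close>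

definition unit_lborel :: "real measure" where
  "unit_lborel = restrict_space lborel {0..<1}"

lemma space_unit_lborel [simp]: "space unit_lborel = {0..<1}"
  by (simp add: unit_lborel_def space_restrict_space)

lemma measurable_unit_lborel [measurable (raw)]:
  "f \<in> borel_measurable borel \<Longrightarrow> f \<in> borel_measurable unit_lborel"
  by (simp add: unit_lborel_def measurable_restrict_space1)

lemma integral_unit_lborel:
  fixes f :: "real \<Rightarrow> 'a::{banach, second_countable_topology}"
  shows "integral\<^sup>L unit_lborel f = (\<integral>t. indicator {0..<1} t *\<^sub>R f t \<partial>lborel)"
  by (simp add: unit_lborel_def integral_restrict_space)

lemma integrable_unit_lborel:
  fixes f :: "real \<Rightarrow> 'a::{banach, second_countable_topology}"
  shows "integrable unit_lborel f \<longleftrightarrow> integrable lborel (\<lambda>t. indicator {0..<1} t *\<^sub>R f t)"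
  by (simp add: unit_lborel_def integrable_restrict_space)

lemma integrable_mult_bounded:
  fixes f :: "real \<Rightarrow> 'a::{real_normed_algebra_1, banach, second_countable_topology}"
  assumes h: "integrable unit_lborel h" and f: "f \<in> borel_measurable borel"
    and B: "\<And>t. 0 \<le> t \<Longrightarrow> t < 1 \<Longrightarrow> norm (f t) \<le> B"
  shows "integrable unit_lborel (\<lambda>t. of_real (h t) * f t)"
proof (rule Bochner_Integration.integrable_bound)
  show "integrable unit_lborel (\<lambda>t. B * h t)" using h by simp
  have [measurable]: "h \<in> borel_measurable unit_lborel" using h by simp
  have [measurable]: "f \<in> borel_measurable unit_lborel" using f by measurable
  show "(\<lambda>t. of_real (h t) * f t) \<in> borel_measurable unit_lborel" by measurable
  have "norm (of_real (h t) * f t) \<le> norm (B * h t)" if "0 \<le> t" "t < 1" for t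
  proof -
    have "norm (of_real (h t) * f t) \<le> \<bar>h t\<bar> * norm (f t)"
      using norm_mult_ineq[of "of_real (h t)" "f t"] by simp
    also have "\<dots> \<le> \<bar>h t\<bar> * \<bar>B\<bar>" using B[OF that] by (intro mult_left_mono) auto
    finally show ?thesis by (simp add: abs_mult mult.commute)
  qed
  then show "AE t in unit_lborel. norm (of_real (h t) * f t) \<le> norm (B * h t)"
    by (intro AE_I2) simp
qed

definition exp_transform :: "(real \<Rightarrow> real) \<Rightarrow> complex \<Rightarrow> complex" where
  "exp_transform h z = (\<integral>t. of_real (h t) * exp (\<i> * z * of_real t) \<partial>unit_lborel)"

lemma norm_exp_unit_le:
  fixes z :: complex
  assumes "0 \<le> t" "t \<le> 1"
  shows "norm (exp (\<i> * z * of_real t)) \<le> exp (norm z)"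
proof -
  have "norm (exp (\<i> * z * of_real t)) \<le> exp (norm (\<i> * z * of_real t))" by (rule norm_exp)
  also have "norm (\<i> * z * of_real t) \<le> norm z" 
    using assms by (simp add: norm_mult mult_left_le)
  finally show ?thesis by simp
qed

lemma integrable_exp_transform:
  assumes "integrable unit_lborel h"
  shows "integrable unit_lborel (\<lambda>t. of_real (h t) * exp (\<i> * z * of_real t))"
proof (rule integrable_mult_bounded[OF assms])
  show "norm (exp (\<i> * z * of_real t)) \<le> exp (norm z)" if "0 \<le> t" "t < 1" for t
    using that by (intro norm_exp_unit_le) auto
qed measurable

lemma exp_transform_diff:
  assumes "integrable unit_lborel g" "integrable unit_lborel h"
  shows "exp_transform (\<lambda>t. g t - h t) z = exp_transform g z - exp_transform h z"
  unfolding exp_transform_def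
  using assms by (simp add: left_diff_distrib integrable_exp_transform Bochner_Integration.integral_diff)

lemma exp_transform_cnj: "exp_transform h (- cnj z) = cnj (exp_transform h z)"
proof -
  have "cnj (exp_transform h z) = (\<integral>t. cnj (of_real (h t) * exp (\<i> * z * of_real t)) \<partial>unit_lborel)"
    unfolding exp_transform_def by (rule Bochner_Integration.integral_cnj[symmetric])
  also have "\<dots> = exp_transform h (- cnj z)"
    unfolding exp_transform_def by (intro Bochner_Integration.integral_cong) (simp_all add: exp_cnj)
  finally show ?thesis by simp
qed

definition cell_mass :: "(real \<Rightarrow> real) \<Rightarrow> nat \<Rightarrow> nat \<Rightarrow> real" where
  "cell_mass h n k = (\<integral>t. indicator {real k / real n ..< real (Suc k) / real n} t * h t \<partial>unit_lborel)"

lemma cell_mass_nonneg: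
  assumes "\<And>t. 0 \<le> t \<Longrightarrow> t < 1 \<Longrightarrow> 0 \<le> h t"
  shows "0 \<le> cell_mass h n k"
  unfolding cell_mass_def using assms by (intro Bochner_Integration.integral_nonneg) auto

lemma integrable_cell:
  fixes h :: "real \<Rightarrow> real"
  assumes "integrable unit_lborel h"
  shows "integrable unit_lborel (\<lambda>t. indicator {a..<b::real} t * h t)"
  using integrable_mult_bounded[OF assms, of "indicator {a..<b} :: real \<Rightarrow> real" 1]
  by (simp add: mult.commute indicator_def)

lemma cell_subset_unit:
  assumes "k < n"
  shows "{real k / real n ..< real (Suc k) / real n} \<subseteq> {0..<1}"
proof -
  have "real (Suc k) / real n \<le> 1" using assms by (simp add: field_simps)
  moreover have "0 \<le> real k / real n" by simp
  ultimately show ?thesis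
    unfolding ivl_subset by blast
qed

lemma cell_mass_lborel:
  assumes "k < n"
  shows "cell_mass h n k = (\<integral>t. indicator {real k / real n ..< real (Suc k) / real n} t * h t \<partial>lborel)"
  unfolding cell_mass_def integral_unit_lborel
  by (rule Bochner_Integration.integral_cong) (use subsetD[OF cell_subset_unit[OF assms]] in \<open>simp_all add: indicator_def\<close>)

lemma integrable_cell_lborel:
  fixes h :: "real \<Rightarrow> real"
  assumes "integrable unit_lborel h" "k < n"
  shows "integrable lborel (\<lambda>t. indicator {real k / real n ..< real (Suc k) / real n} t * h t)"
proof -
  have "(\<lambda>t. indicator {0..<1} t *\<^sub>R (indicator {real k / real n ..< real (Suc k) / real n} t * h t)) =
        (\<lambda>t. indicator {real k / real n ..< real (Suc k) / real n} t * h t)"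
    using subsetD[OF cell_subset_unit[OF assms(2)]] by (intro ext) (simp add: indicator_def)
  then show ?thesis using integrable_cell[OF assms(1)] unfolding integrable_unit_lborel by metis
qed

text \<open>The next cell is the translate of the present one by \<open>1 / n\<close>, and \<open>h\<close> does not decrease under this
  translation.\<close>

lemma cell_mass_mono:
  assumes h: "integrable unit_lborel h" and mono: "mono_on {0..<1} h" and k: "Suc k < n"
  shows "cell_mass h n k \<le> cell_mass h n (Suc k)"
proof -
  let ?I = "\<lambda>k. {real k / real n ..< real (Suc k) / real n}"
  have n: "real n > 0" using k by simp
  have Suc_div: "real (Suc j) / real n = 1 / real n + real j / real n" for j
    by (simp add: add_divide_distrib)
  have cell_shift: "1 / real n + t \<in> ?I (Suc k) \<longleftrightarrow> t \<in> ?I k" for t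
    unfolding Suc_div[of "Suc k"] Suc_div[of k] atLeastLessThan_iff by linarith
  then have shift: "indicator (?I (Suc k)) (1 / real n + 1 * t) = (indicator (?I k) t :: real)" for t
    unfolding indicator_def mult_1 by presburger
  have "cell_mass h n (Suc k) = (\<integral>t. indicator (?I (Suc k)) t * h t \<partial>lborel)"
    by (rule cell_mass_lborel[OF k])
  also have "\<dots> = (\<integral>t. indicator (?I k) t * h (1 / real n + 1 * t) \<partial>lborel)"
    by (subst lborel_integral_real_affine[where c = 1 and t = "1 / real n"]) (simp_all add: shift[simplified])
  also have "(\<integral>t. indicator (?I k) t * h t \<partial>lborel) \<le> \<dots>"
  proof (rule integral_mono)
    show "integrable lborel (\<lambda>t. indicator (?I k) t * h t)"
      using h k by (intro integrable_cell_lborel) auto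
    have "integrable lborel (\<lambda>t. indicator (?I (Suc k)) (1 / real n + 1 * t) * h (1 / real n + 1 * t))"
      by (rule lborel_integrable_real_affine[OF integrable_cell_lborel[OF h k]]) simp
    then show "integrable lborel (\<lambda>t. indicator (?I k) t * h (1 / real n + 1 * t))"
      unfolding shift .
    fix t :: real
    show "indicator (?I k) t * h t \<le> indicator (?I k) t * h (1 / real n + 1 * t)"
    proof (cases "t \<in> ?I k")
      case True
      then have "1 / real n + t \<in> ?I (Suc k)" unfolding cell_shift .
      then have "1 / real n + t \<in> {0..<1}" using cell_subset_unit[OF k] by blast
      moreover have "t \<in> {0..<1}" using subsetD[OF cell_subset_unit[of k n] True] k by simp
      ultimately show ?thesis using mono n by (auto simp: indicator_def intro: mono_onD)
    qed auto
  qed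
  also have "(\<integral>t. indicator (?I k) t * h t \<partial>lborel) = cell_mass h n k"
    using k by (intro cell_mass_lborel[symmetric]) auto
  finally show ?thesis by simp
qed

lemma sum_cells:
  fixes f :: "nat \<Rightarrow> complex"
  assumes t: "0 \<le> t" "t < 1" and n: "n > 0"
  shows "(\<Sum>k<n. indicator {real k / real n ..< real (Suc k) / real n} t * f k) = f (nat \<lfloor>real n * t\<rfloor>)"
proof -
  let ?m = "nat \<lfloor>real n * t\<rfloor>"
  have "?m < n"
    using t n by (simp add: nat_less_iff floor_less_iff)
  have iff: "t \<in> {real k / real n ..< real (Suc k) / real n} \<longleftrightarrow> k = ?m" for k
  proof -
    have "t \<in> {real k / real n ..< real (Suc k) / real n} \<longleftrightarrow> real k \<le> real n * t \<and> real n * t < real k + 1"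
      using n by (auto simp: field_simps)
    also have "\<dots> \<longleftrightarrow> \<lfloor>real n * t\<rfloor> = int k" by (simp add: floor_eq_iff)
    also have "\<dots> \<longleftrightarrow> k = ?m" using t by (auto simp: nat_eq_iff)
    finally show ?thesis .
  qed
  have "(\<Sum>k<n. indicator {real k / real n ..< real (Suc k) / real n} t * f k) = (\<Sum>k<n. if k = ?m then f k else 0)"
    using iff by (intro sum.cong) (auto simp: indicator_def)
  also have "\<dots> = f ?m" using \<open>?m < n\<close> by simp
  finally show ?thesis .
qed

lemma floor_scaled_tendsto:
  fixes t :: real
  assumes "0 \<le> t"
  shows "(\<lambda>n. real (nat \<lfloor>real (Suc n) * t\<rfloor>) / real (Suc n)) \<longlonglongrightarrow> t"
proof (rule real_tendsto_sandwich)
  show "\<forall>\<^sub>F n in sequentially. t - 1 / real (Suc n) \<le> real (nat \<lfloor>real (Suc n) * t\<rfloor>) / real (Suc n)"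
  proof (rule always_eventually, rule allI)
    fix n
    have "real (Suc n) * t - 1 \<le> of_int \<lfloor>real (Suc n) * t\<rfloor>" by linarith
    also have "\<dots> = real (nat \<lfloor>real (Suc n) * t\<rfloor>)" using assms by simp
    finally have "(real (Suc n) * t - 1) / real (Suc n) \<le> real (nat \<lfloor>real (Suc n) * t\<rfloor>) / real (Suc n)"
      by (intro divide_right_mono) auto
    then show "t - 1 / real (Suc n) \<le> real (nat \<lfloor>real (Suc n) * t\<rfloor>) / real (Suc n)"
      by (simp add: diff_divide_distrib)
  qed
  show "\<forall>\<^sub>F n in sequentially. real (nat \<lfloor>real (Suc n) * t\<rfloor>) / real (Suc n) \<le> t"
  proof (rule always_eventually, rule allI)
    fix n
    have "real (nat \<lfloor>real (Suc n) * t\<rfloor>) = of_int \<lfloor>real (Suc n) * t\<rfloor>" using assms by simp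
    also have "\<dots> \<le> real (Suc n) * t" by linarith
    finally show "real (nat \<lfloor>real (Suc n) * t\<rfloor>) / real (Suc n) \<le> t" by (simp add: field_simps)
  qed
  have "(\<lambda>n. 1 / real (Suc n)) \<longlonglongrightarrow> 0" using LIMSEQ_inverse_real_of_nat by (simp add: inverse_eq_divide)
  then show "(\<lambda>n. t - 1 / real (Suc n)) \<longlonglongrightarrow> t" using tendsto_diff[OF tendsto_const[of t]] by fastforce
qed simp

text \<open>The sum is the integral of \<open>h\<close> against the exponential evaluated at the left endpoint of the cell
  that contains \<open>t\<close>, so this is dominated convergence. Averaging over cells, instead of sampling \<open>h\<close>,
  avoids any difficulty with unbounded \<open>h\<close>.\<close>

lemma exp_transform_cell_sums:
  assumes h: "integrable unit_lborel h"
  shows "(\<lambda>n. \<Sum>k\<le>n. of_real (cell_mass h (Suc n) k) * exp (\<i> * z / of_nat (Suc n)) ^ k)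
    \<longlonglongrightarrow> exp_transform h z"
proof -
  have [measurable]: "h \<in> borel_measurable unit_lborel" using h by simp
  define q where "q n t = real (nat \<lfloor>real (Suc n) * t\<rfloor>) / real (Suc n)" for n t
  have [measurable]: "q n \<in> borel_measurable borel" for n unfolding q_def by measurable
  have [measurable]: "q n \<in> borel_measurable unit_lborel" for n by measurable
  have eq: "(\<Sum>k\<le>n. of_real (cell_mass h (Suc n) k) * exp (\<i> * z / of_nat (Suc n)) ^ k) =
     (\<integral>t. of_real (h t) * exp (\<i> * z * of_real (q n t)) \<partial>unit_lborel)" for n
  proof -
    let ?I = "\<lambda>k. {real k / real (Suc n) ..< real (Suc k) / real (Suc n)}"
    let ?f = "\<lambda>k. exp (\<i> * z * of_real (real k / real (Suc n)))"
    have "(\<Sum>k\<le>n. of_real (cell_mass h (Suc n) k) * exp (\<i> * z / of_nat (Suc n)) ^ k) =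
      (\<Sum>k<Suc n. of_real (cell_mass h (Suc n) k) * ?f k)"
      unfolding lessThan_Suc_atMost by (intro sum.cong) (auto simp: field_simps simp flip: exp_of_nat_mult)
    also have "\<dots> = (\<Sum>k<Suc n. \<integral>t. of_real (indicator (?I k) t * h t) * ?f k \<partial>unit_lborel)"
      unfolding cell_mass_def by (simp add: h integrable_cell del: of_real_mult of_real_divide)
    also have "\<dots> = (\<integral>t. (\<Sum>k<Suc n. of_real (indicator (?I k) t * h t) * ?f k) \<partial>unit_lborel)"
      using h by (intro Bochner_Integration.integral_sum[symmetric] integrable_mult_left
         integrable_of_real integrable_cell)
    also have "\<dots> = (\<integral>t. of_real (h t) * exp (\<i> * z * of_real (q n t)) \<partial>unit_lborel)"
    proof (rule Bochner_Integration.integral_cong)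
      fix t assume "t \<in> space unit_lborel"
      then have t: "0 \<le> t" "t < 1" by auto
      have "(\<Sum>k<Suc n. of_real (indicator (?I k) t * h t) * ?f k) =
         of_real (h t) * (\<Sum>k<Suc n. indicator (?I k) t * ?f k)"
        unfolding sum_distrib_left by (intro sum.cong) (auto simp: indicator_def)
      also have "(\<Sum>k<Suc n. indicator (?I k) t * ?f k) = ?f (nat \<lfloor>real (Suc n) * t\<rfloor>)"
        by (rule sum_cells[OF t]) simp
      finally show "(\<Sum>k<Suc n. of_real (indicator (?I k) t * h t) * ?f k) =
        of_real (h t) * exp (\<i> * z * of_real (q n t))" unfolding q_def .
    qed simp
    finally show ?thesis .
  qed
  have q: "0 \<le> q n t" "q n t \<le> 1" if "0 \<le> t" "t < 1" for n t
  proof -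
    show "0 \<le> q n t" unfolding q_def by simp
    have "real (nat \<lfloor>real (Suc n) * t\<rfloor>) = of_int \<lfloor>real (Suc n) * t\<rfloor>" using that by simp
    also have "\<dots> \<le> real (Suc n) * t" by linarith
    also have "\<dots> \<le> real (Suc n) * 1" using that by (intro mult_left_mono) auto
    finally show "q n t \<le> 1" unfolding q_def by (simp add: field_simps)
  qed
  show ?thesis
    unfolding eq exp_transform_def
  proof (rule integral_dominated_convergence)
    show "integrable unit_lborel (\<lambda>t. exp (norm z) * norm (h t))" using h by simp
    show "AE t in unit_lborel. (\<lambda>n. of_real (h t) * exp (\<i> * z * of_real (q n t)))
        \<longlonglongrightarrow> of_real (h t) * exp (\<i> * z * of_real t)"
    proof (rule AE_I2)
      fix t assume "t \<in> space unit_lborel"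
      then have "(\<lambda>n. q n t) \<longlonglongrightarrow> t" unfolding q_def by (intro floor_scaled_tendsto) simp
      then show "(\<lambda>n. of_real (h t) * exp (\<i> * z * of_real (q n t)))
        \<longlonglongrightarrow> of_real (h t) * exp (\<i> * z * of_real t)" by (intro tendsto_intros)
    qed
    show "AE t in unit_lborel. norm (of_real (h t) * exp (\<i> * z * of_real (q n t))) \<le> exp (norm z) * norm (h t)" for n
    proof (rule AE_I2)
      fix t assume "t \<in> space unit_lborel"
      then show "norm (of_real (h t) * exp (\<i> * z * of_real (q n t))) \<le> exp (norm z) * norm (h t)"
        using norm_exp_unit_le[OF q(1)[of t n] q(2)[of t n], of z] mult_right_mono[of _ _ "norm (h t)"]
        by (simp add: norm_mult mult.commute[of "\<bar>h t\<bar>"])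
    qed
  qed measurable
qed

lemma exp_rate_tendsto:
  fixes c :: complex
  shows "(\<lambda>n. of_nat (Suc n) * (1 - exp (- (c / of_nat (Suc n))))) \<longlonglongrightarrow> c"
proof -
  have "((\<lambda>x. exp (- (c * x))) has_field_derivative - c) (at 0)"
    by (auto intro!: derivative_eq_intros)
  then have lim: "((\<lambda>x. (exp (- (c * x)) - 1) / x) \<longlongrightarrow> - c) (at 0)"
    by (simp add: has_field_derivative_iff)
  have "filterlim (\<lambda>n. inverse (of_nat (Suc n)) :: complex) (at 0) sequentially"
    using LIMSEQ_Suc[OF lim_inverse_n] by (intro filterlim_atI) (auto simp del: of_nat_Suc)
  from filterlim_compose[OF lim this] have
    "(\<lambda>n. - ((exp (- (c * inverse (of_nat (Suc n)))) - 1) / inverse (of_nat (Suc n)))) \<longlonglongrightarrow> - (- c)"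
    by (rule tendsto_minus)
  then show ?thesis by (simp add: field_simps del: of_nat_Suc)
qed

lemma exp_power_tendsto:
  fixes c :: complex
  shows "(\<lambda>n. exp (c / of_nat (Suc n)) ^ n) \<longlonglongrightarrow> exp c"
proof -
  have "(\<lambda>n. of_nat n / of_nat (Suc n) :: complex) \<longlonglongrightarrow> 1"
    by (rule LIMSEQ_n_over_Suc_n)
  then have "(\<lambda>n. exp (c * (of_nat n / of_nat (Suc n)))) \<longlonglongrightarrow> exp (c * 1)"
    by (intro tendsto_intros)
  then show ?thesis by (simp add: exp_of_nat_mult[symmetric] field_simps del: of_nat_Suc)
qed

lemma norm_exp_i: "norm (exp (\<i> * z / of_nat n)) = exp (- Im z / real n)"
  by (simp add: norm_exp_eq_Re)

text \<open>The limit of \<open>Re_decreasing_coeffs_ge\<close> with \<open>v = exp (- i z / n)\<close>: the factor \<open>n (1 - v)\<close> tends to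
  \<open>i z\<close>, and reversing the order of the coefficients contributes \<open>v ^ (n - 1)\<close>, which tends to
  \<open>exp (- i z)\<close>. On the real axis the statement says that the sine transform of a decreasing function
  is nonnegative on the positive axis.\<close>

proposition Re_exp_transform_nonneg:
  assumes h: "integrable unit_lborel h" and nonneg: "\<And>t. 0 \<le> t \<Longrightarrow> t < 1 \<Longrightarrow> 0 \<le> h t"
    and mono: "mono_on {0..<1} h" and z: "Im z \<le> 0"
  shows "0 \<le> Re (\<i> * z * exp (- (\<i> * z)) * exp_transform h z)"
proof -
  define w where "w n = exp (\<i> * z / of_nat (Suc n))" for n
  define P where "P n = (\<Sum>k\<le>n. of_real (cell_mass h (Suc n) k) * w n ^ k)" for n
  define X where "X n = of_nat (Suc n) * (1 - inverse (w n)) * inverse (w n) ^ n * P n" for n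
  have inv: "inverse (w n) = exp (- (\<i> * z / of_nat (Suc n)))" for n
    unfolding w_def exp_minus ..
  have "X \<longlonglongrightarrow> \<i> * z * exp (- (\<i> * z)) * exp_transform h z"
  proof -
    have "(\<lambda>n. of_nat (Suc n) * (1 - inverse (w n))) \<longlonglongrightarrow> \<i> * z"
      unfolding inv by (rule exp_rate_tendsto)
    moreover have "(\<lambda>n. inverse (w n) ^ n) \<longlonglongrightarrow> exp (- (\<i> * z))"
      unfolding inv minus_divide_left by (rule exp_power_tendsto)
    moreover have "P \<longlonglongrightarrow> exp_transform h z"
      unfolding P_def w_def by (rule exp_transform_cell_sums[OF h])
    ultimately show ?thesis unfolding X_def by (rule tendsto_mult[OF tendsto_mult])
  qed
  then have "(\<lambda>n. Re (X n)) \<longlonglongrightarrow> Re (\<i> * z * exp (- (\<i> * z)) * exp_transform h z)"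
    by (rule tendsto_Re)
  moreover have "0 \<le> Re (X n)" for n
  proof -
    have nz: "w n \<noteq> 0" unfolding w_def by simp
    have v: "norm (inverse (w n)) \<le> 1"
      unfolding norm_inverse w_def norm_exp_i exp_minus[symmetric] using z by (simp add: divide_nonpos_nonneg)
    have dec: "cell_mass h (Suc n) (n - Suc j) \<le> cell_mass h (Suc n) (n - j)" if "j < n" for j
      using cell_mass_mono[OF h mono, of "n - Suc j" "Suc n"] that by (simp add: Suc_diff_Suc)
    let ?S = "\<Sum>j\<le>n. of_real (cell_mass h (Suc n) (n - j)) * inverse (w n) ^ j"
    have "0 \<le> (1 - norm (inverse (w n))) * cell_mass h (Suc n) (n - 0)"
      using v cell_mass_nonneg nonneg by (intro mult_nonneg_nonneg) auto
    also have "\<dots> \<le> Re ((1 - inverse (w n)) * ?S)"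
      using dec v cell_mass_nonneg nonneg by (intro Re_decreasing_coeffs_ge) auto
    finally have "0 \<le> real (Suc n) * Re ((1 - inverse (w n)) * ?S)"
      by (intro mult_nonneg_nonneg) auto
    also have "\<dots> = Re (of_real (real (Suc n)) * ((1 - inverse (w n)) * ?S))"
      by (simp only: Re_complex_of_real Im_complex_of_real times_complex.sel)
    also have "of_real (real (Suc n)) * ((1 - inverse (w n)) * ?S) = X n"
    proof -
      have "inverse (w n) ^ n * (w n ^ n * ?S) = ?S"
        using nz by (simp add: field_simps)
      then show ?thesis unfolding X_def P_def reversed_poly_sum[OF nz] by (simp add: mult.assoc)
    qed
    finally show ?thesis .
  qed
  ultimately show ?thesis by (intro LIMSEQ_le_const) auto
qed

text \<open>The limit of \<open>norm_reciprocal_poly_le\<close> with \<open>w = exp (i z / n)\<close>. The factor \<open>exp (- Im z)\<close> is the limit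
  of \<open>norm (w ^ d)\<close>; it makes the inequality strict off the real axis and is also what makes the
  zeros of the cosine transform simple.\<close>

proposition norm_exp_transform_reflect_le:
  assumes h: "integrable unit_lborel h" and nonneg: "\<And>t. 0 \<le> t \<Longrightarrow> t < 1 \<Longrightarrow> 0 \<le> h t"
    and mono: "mono_on {0..<1} h" and z: "Im z \<le> 0"
  shows "exp (- Im z) * norm (exp_transform h (- z)) \<le> norm (exp_transform h z)"
proof -
  define w where "w n = exp (\<i> * z / of_nat (Suc n))" for n
  have inv: "inverse (w n) = exp (\<i> * (- z) / of_nat (Suc n))" for n
    unfolding w_def by (simp add: exp_minus)
  have "(\<lambda>n. norm (w n ^ n * (\<Sum>k\<le>n. of_real (cell_mass h (Suc n) k) * inverse (w n) ^ k)))
        \<longlonglongrightarrow> norm (exp (\<i> * z) * exp_transform h (- z))"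
    unfolding inv unfolding w_def
    by (intro tendsto_norm tendsto_mult exp_power_tendsto exp_transform_cell_sums h)
  moreover have "(\<lambda>n. norm (\<Sum>k\<le>n. of_real (cell_mass h (Suc n) k) * w n ^ k))
        \<longlonglongrightarrow> norm (exp_transform h z)"
    unfolding w_def by (intro tendsto_norm exp_transform_cell_sums h)
  moreover have "norm (w n ^ n * (\<Sum>k\<le>n. of_real (cell_mass h (Suc n) k) * inverse (w n) ^ k)) \<le>
        norm (\<Sum>k\<le>n. of_real (cell_mass h (Suc n) k) * w n ^ k)" for n
  proof (rule norm_reciprocal_poly_le)
    show "1 \<le> norm (w n)" unfolding w_def norm_exp_i using z by (simp add: divide_nonpos_nonneg)
    show "0 \<le> cell_mass h (Suc n) 0" using nonneg by (rule cell_mass_nonneg)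
    show "cell_mass h (Suc n) j \<le> cell_mass h (Suc n) (Suc j)" if "j < n" for j
      using that by (intro cell_mass_mono h mono) simp
  qed
  ultimately have "norm (exp (\<i> * z) * exp_transform h (- z)) \<le> norm (exp_transform h z)"
    by (intro LIMSEQ_le) auto
  then show ?thesis by (simp add: norm_mult norm_exp_eq_Re)
qed

section \<open>Power series and primitives\<close>

lemma integrable_moment:
  assumes "integrable unit_lborel h"
  shows "integrable unit_lborel (\<lambda>t. h t * t ^ k)"
  using integrable_mult_bounded[OF assms, of "\<lambda>t. t ^ k" 1] by (simp add: power_le_one)

lemma exp_transform_sums:
  assumes h: "integrable unit_lborel h"
  shows "(\<lambda>k. of_real (\<integral>t. h t * t ^ k \<partial>unit_lborel) * (\<i> * z) ^ k / fact k) sums exp_transform h z"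
proof -
  define f where "f k t = of_real (h t * t ^ k) * ((\<i> * z) ^ k / fact k)" for k t
  have int: "integrable unit_lborel (f k)" for k
    unfolding f_def by (intro integrable_mult_left integrable_of_real integrable_moment h)
  have norm_f: "norm (f k t) \<le> \<bar>h t\<bar> * (norm z ^ k / fact k)" if "0 \<le> t" "t < 1" for k t
  proof -
    have "norm (f k t) = (\<bar>h t\<bar> * t ^ k) * (norm z ^ k / fact k)"
      using that by (simp add: f_def norm_mult norm_divide norm_power abs_mult power_mult_distrib)
    also have "\<dots> \<le> (\<bar>h t\<bar> * 1) * (norm z ^ k / fact k)"
      using that by (intro mult_right_mono mult_left_mono) (auto simp: power_le_one)
    finally show ?thesis by simp
  qed
  have summ: "summable (\<lambda>k. C * (norm z ^ k / fact k))" for C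
    using summable_exp[of "norm z"] by (intro summable_mult) (simp add: divide_inverse mult.commute)
  have "(\<lambda>k. integral\<^sup>L unit_lborel (f k)) sums (\<integral>t. (\<Sum>k. f k t) \<partial>unit_lborel)"
  proof (rule sums_integral)
    show "AE t in unit_lborel. summable (\<lambda>k. norm (f k t))"
    proof (rule AE_I2)
      fix t assume "t \<in> space unit_lborel"
      then show "summable (\<lambda>k. norm (f k t))"
        using norm_f by (intro summable_comparison_test'[OF summ[of "\<bar>h t\<bar>"]]) auto
    qed
    show "summable (\<lambda>k. \<integral>t. norm (f k t) \<partial>unit_lborel)"
    proof (rule summable_comparison_test'[OF summ[of "\<integral>t. \<bar>h t\<bar> \<partial>unit_lborel"]])
      fix k :: nat
      have "(\<integral>t. norm (f k t) \<partial>unit_lborel) \<le> (\<integral>t. \<bar>h t\<bar> * (norm z ^ k / fact k) \<partial>unit_lborel)"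
        using h int norm_f by (intro integral_mono integrable_norm integrable_mult_left integrable_abs) auto
      then show "norm (\<integral>t. norm (f k t) \<partial>unit_lborel) \<le> (\<integral>t. \<bar>h t\<bar> \<partial>unit_lborel) * (norm z ^ k / fact k)"
        by (simp add: Bochner_Integration.integral_nonneg)
    qed
  qed (rule int)
  also have "(\<integral>t. (\<Sum>k. f k t) \<partial>unit_lborel) = exp_transform h z"
    unfolding exp_transform_def
  proof (rule Bochner_Integration.integral_cong)
    fix t
    have "(\<lambda>k. of_real (h t) * ((\<i> * z * of_real t) ^ k /\<^sub>R fact k)) sums (of_real (h t) * exp (\<i> * z * of_real t))"
      by (intro sums_mult exp_converges)
    also have "(\<lambda>k. of_real (h t) * ((\<i> * z * of_real t) ^ k /\<^sub>R fact k)) = (\<lambda>k. f k t)"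
      by (intro ext) (simp add: f_def power_mult_distrib scaleR_conv_of_real divide_inverse mult_ac)
    finally show "(\<Sum>k. f k t) = of_real (h t) * exp (\<i> * z * of_real t)" by (rule sums_unique[symmetric])
  qed simp
  also have "(\<lambda>k. integral\<^sup>L unit_lborel (f k)) =
     (\<lambda>k. of_real (\<integral>t. h t * t ^ k \<partial>unit_lborel) * (\<i> * z) ^ k / fact k)"
    unfolding f_def using integrable_moment[OF h] by (intro ext) (simp del: of_real_mult)
  finally show ?thesis .
qed

lemma exp_transform_differentiable:
  assumes h: "integrable unit_lborel h"
  shows "\<exists>D. (exp_transform h has_field_derivative D) (at z)"
proof -
  define c where "c k = of_real (\<integral>t. h t * t ^ k \<partial>unit_lborel) * \<i> ^ k / fact k" for k
  have sums: "(\<lambda>k. c k * z ^ k) sums exp_transform h z" for z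
    using exp_transform_sums[OF h, of z] by (simp add: c_def power_mult_distrib mult_ac)
  have "((\<lambda>z. \<Sum>k. c k * z ^ k) has_field_derivative (\<Sum>k. diffs c k * z ^ k)) (at z)"
    using sums by (intro termdiffs_strong_converges_everywhere) (auto simp: sums_iff)
  moreover have "(\<lambda>z. \<Sum>k. c k * z ^ k) = exp_transform h"
    using sums by (simp add: sums_iff fun_eq_iff)
  ultimately show ?thesis by auto
qed

text \<open>Gives access to the fundamental theorem of calculus for integrands that are unbounded at an
  endpoint.\<close>

lemma has_integral_unit_lborel:
  fixes f :: "real \<Rightarrow> 'a::euclidean_space"
  assumes "integrable unit_lborel f"
  shows "(f has_integral integral\<^sup>L unit_lborel f) {0..1}"
proof -
  have "((\<lambda>t. indicator {0..<1} t *\<^sub>R f t) has_integral integral\<^sup>L unit_lborel f) UNIV"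
    using assms unfolding integrable_unit_lborel integral_unit_lborel by (rule has_integral_integral_lborel)
  also have "(\<lambda>t. indicator {0..<1} t *\<^sub>R f t) = (\<lambda>t. if t \<in> {0..<1} then f t else 0)"
    by (auto simp: fun_eq_iff)
  finally have "(f has_integral integral\<^sup>L unit_lborel f) {0..<1}"
    unfolding has_integral_restrict_UNIV .
  then show ?thesis
    by (subst has_integral_spike_set_eq[of _ "{0..<1}"]) (auto intro: negligible_subset[of "{1::real}"])
qed

text \<open>The integrand may be unbounded at 1, so continuity of the primitive up to the endpoints is
  required separately.\<close>

lemma integral_unit_lborel_FTC:
  fixes F f :: "real \<Rightarrow> 'a::euclidean_space"
  assumes int: "integrable unit_lborel f"
    and "continuous_on {0..1} F"
    and "\<And>t. 0 < t \<Longrightarrow> t < 1 \<Longrightarrow> (F has_vector_derivative f t) (at t)"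
  shows "integral\<^sup>L unit_lborel f = F 1 - F 0"
proof (rule has_integral_unique)
  show "(f has_integral F 1 - F 0) {0..1}"
    using assms by (intro fundamental_theorem_of_calculus_interior) auto
qed (rule has_integral_unit_lborel[OF int])

lemma integrable_unit_lborel_bounded:
  fixes f :: "real \<Rightarrow> real"
  assumes "f \<in> borel_measurable borel" "\<And>t. 0 \<le> t \<Longrightarrow> t < 1 \<Longrightarrow> \<bar>f t\<bar> \<le> B"
  shows "integrable unit_lborel f"
proof -
  have "integrable unit_lborel (\<lambda>t. 1 :: real)"
    by (simp add: integrable_unit_lborel)
  from integrable_mult_bounded[OF this assms(1), of B] assms(2) show ?thesis by simp
qed

lemma exp_transform_const:
  assumes "z \<noteq> 0"
  shows "exp_transform (\<lambda>_. c) z = of_real c * ((exp (\<i> * z) - 1) / (\<i> * z))"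
proof -
  define F where "F t = of_real c * (exp (\<i> * z * of_real t) / (\<i> * z))" for t :: real
  have "exp_transform (\<lambda>_. c) z = F 1 - F 0"
    unfolding exp_transform_def
  proof (rule integral_unit_lborel_FTC)
    show "integrable unit_lborel (\<lambda>t. complex_of_real c * exp (\<i> * z * complex_of_real t))"
      by (intro integrable_exp_transform integrable_unit_lborel_bounded[where B = "\<bar>c\<bar>"]) auto
    show "continuous_on {0..1} F" unfolding F_def using assms by (intro continuous_intros) auto
    show "(F has_vector_derivative complex_of_real c * exp (\<i> * z * complex_of_real t)) (at t)" for t
      unfolding F_def using assms
      by (auto intro!: derivative_eq_intros has_vector_derivative_real_field)
  qed
  then show ?thesis by (simp add: F_def algebra_simps diff_divide_distrib)
qed

lemma exp_transform_square:
  assumes "z \<noteq> 0"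
  shows "exp_transform (\<lambda>t. d * t\<^sup>2) z = of_real d *
    (exp (\<i> * z) * (1 / (\<i> * z) - 2 / (\<i> * z)\<^sup>2 + 2 / (\<i> * z) ^ 3) - 2 / (\<i> * z) ^ 3)"
proof -
  define c where "c = \<i> * z"
  have [simp]: "c \<noteq> 0" using assms by (simp add: c_def)
  define F where "F t = of_real d * (exp (c * t) * (t\<^sup>2 / c - 2 * t / c\<^sup>2 + 2 / c ^ 3))" for t :: complex
  have "exp_transform (\<lambda>t. d * t\<^sup>2) z = F (of_real 1) - F (of_real 0)"
    unfolding exp_transform_def
  proof (rule integral_unit_lborel_FTC)
    show "integrable unit_lborel (\<lambda>t. complex_of_real (d * t\<^sup>2) * exp (\<i> * z * complex_of_real t))"
      by (intro integrable_exp_transform integrable_unit_lborel_bounded[where B = "\<bar>d\<bar>"])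
         (auto simp: abs_mult power_le_one mult_left_le)
    show "continuous_on {0..1} (\<lambda>t. F (complex_of_real t))" unfolding F_def by (intro continuous_intros) auto
    have "(F has_field_derivative of_real d * w\<^sup>2 * exp (c * w)) (at w)" for w
      unfolding F_def
      by (rule derivative_eq_intros refl | simp)+ (simp add: field_simps power2_eq_square power3_eq_cube power4_eq_xxxx)
    from has_vector_derivative_real_field[OF this]
    show "((\<lambda>t. F (complex_of_real t)) has_vector_derivative complex_of_real (d * t\<^sup>2) * exp (\<i> * z * complex_of_real t)) (at t)" for t
      by (simp add: c_def)
  qed
  then show ?thesis by (simp add: F_def c_def[symmetric] algebra_simps)
qed

lemma one_minus_cos_less:
  assumes "x > (0::real)"
  shows "1 - x\<^sup>2 / 2 < cos x"
proof -
  have sin_less: "\<bar>sin y\<bar> < y" if "y > 0" for y :: real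
  proof (cases "y < 2")
    case True
    have "0 < sin (y / 2)" "0 < sin y" using that True pi_ge_two by (auto intro!: sin_gt_zero)
    moreover have "cos (y / 2) < 1"
      using cos_monotone_0_pi[of 0 "y / 2"] that True pi_ge_two by simp
    ultimately have "2 * sin (y / 2) * cos (y / 2) < 2 * sin (y / 2) * 1"
      by (intro mult_strict_left_mono) auto
    also have "\<dots> \<le> y" using sin_x_le_x[of "y / 2"] that by simp
    finally show ?thesis using sin_double[of "y / 2"] \<open>0 < sin y\<close> by simp
  next
    case False
    then show ?thesis using abs_sin_le_one[of y] by linarith
  qed
  have "\<bar>sin (x / 2)\<bar> < x / 2" using sin_less[of "x / 2"] assms by simp
  then have "(sin (x / 2))\<^sup>2 < (x / 2)\<^sup>2"
    using power_strict_mono[of "\<bar>sin (x/2)\<bar>" "x/2" 2] by simp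
  moreover have "cos x = 1 - 2 * (sin (x / 2))\<^sup>2"
    using cos_double_sin[of "x/2"] by simp
  ultimately show ?thesis by (simp add: power2_eq_square)
qed

definition cos_transform :: "(real \<Rightarrow> real) \<Rightarrow> complex \<Rightarrow> complex" where
  "cos_transform h z = (\<integral>t. of_real (h t) * cos (z * of_real t) \<partial>unit_lborel)"

lemma cos_transform_exp:
  assumes "integrable unit_lborel h"
  shows "cos_transform h z = (exp_transform h z + exp_transform h (- z)) / 2"
proof -
  have "cos_transform h z = (\<integral>t. (of_real (h t) * exp (\<i> * z * of_real t) + of_real (h t) * exp (\<i> * (- z) * of_real t)) / 2 \<partial>unit_lborel)"
    unfolding cos_transform_def cos_exp_eq
    by (intro Bochner_Integration.integral_cong) (simp_all add: field_simps)
  then show ?thesis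
    unfolding exp_transform_def using integrable_exp_transform[OF assms, of z] integrable_exp_transform[OF assms, of "-z"]
    by simp
qed

section \<open>Zeros of cosine transforms of increasing weights\<close>

text \<open>A differentiable function that starts out positive can reach 0 only with a nonpositive derivative:
  consider the first point at which it is not positive.\<close>

lemma stays_positive:
  fixes c c' :: "real \<Rightarrow> real"
  assumes der: "\<And>x. p \<le> x \<Longrightarrow> x \<le> q \<Longrightarrow> (c has_real_derivative c' x) (at x)"
    and "p \<le> q" and "0 < c p"
    and up: "\<And>x. p < x \<Longrightarrow> x \<le> q \<Longrightarrow> c x = 0 \<Longrightarrow> 0 < c' x"
  shows "0 < c q"
proof (rule ccontr)
  assume neg: "\<not> 0 < c q"
  have cont: "continuous_on {p..q} c"
    by (intro continuous_at_imp_continuous_on ballI DERIV_isCont[OF der]) auto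
  define Z where "Z = {x \<in> {p..q}. c x \<le> 0}"
  have Z_eq: "Z = {p..q} \<inter> c -` {..0}" by (auto simp: Z_def)
  have "closed Z"
    unfolding Z_eq using cont by (rule continuous_closed_preimage) auto
  then have "compact Z"
    using compact_Int_closed[of "{p..q}" Z] by (simp add: Z_eq Int_assoc[symmetric])
  then obtain r where r: "r \<in> Z" "\<And>x. x \<in> Z \<Longrightarrow> r \<le> x"
    using compact_attains_inf[of Z] neg \<open>p \<le> q\<close> by (force simp: Z_def)
  have pr: "p < r" "r \<le> q" "c r \<le> 0" using r(1) \<open>0 < c p\<close> by (auto simp: Z_def order.order_iff_strict)
  have "c r = 0"
  proof (rule ccontr)
    assume "c r \<noteq> 0"
    then obtain x where "p \<le> x" "x \<le> r" "c x = 0"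
      using IVT2'[of c r 0 p] pr \<open>0 < c p\<close> continuous_on_subset[OF cont, of "{p..r}"] by auto
    then show False using r(2)[of x] pr \<open>c r \<noteq> 0\<close> by (auto simp: Z_def)
  qed
  then obtain d where d: "d > 0" "\<And>h. 0 < h \<Longrightarrow> h < d \<Longrightarrow> c (r - h) < c r"
    using DERIV_pos_inc_left[OF der up, of r] pr by auto
  define h where "h = min (d / 2) (r - p)"
  have "c (r - h) < 0" using d(2)[of h] d(1) pr \<open>c r = 0\<close> by (simp add: h_def)
  then have "r - h \<in> Z" using pr d(1) by (auto simp: Z_def h_def)
  then show False using r(2) d(1) pr by (force simp: h_def)
qed

text \<open>Subtracting \<open>\<delta> t\<^sup>2\<close> from the weight makes its strict growth quantitative. Mere monotonicity would
  allow \<open>g = 1\<close>, for which \<open>E\<close> vanishes at the nonzero multiples of \<open>2 \<pi>\<close> and the strict inequality of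
  \<open>Re_rotated_E_pos\<close> fails.\<close>

locale polya_weight =
  fixes g :: "real \<Rightarrow> real" and \<delta> :: real
  assumes integrable: "integrable unit_lborel g"
    and mono_minus_square: "mono_on {0..<1} (\<lambda>t. g t - \<delta> * t\<^sup>2)"
    and delta_pos: "\<delta> > 0" and zero_pos: "g 0 > 0"
begin

abbreviation "E \<equiv> exp_transform g"
abbreviation "C \<equiv> cos_transform g"

lemma g_mono: "mono_on {0..<1} g"
proof (rule mono_onI)
  fix s t :: real assume st: "s \<in> {0..<1}" "t \<in> {0..<1}" "s \<le> t"
  then have "g s - \<delta> * s\<^sup>2 \<le> g t - \<delta> * t\<^sup>2" by (rule mono_onD[OF mono_minus_square])
  moreover have "\<delta> * s\<^sup>2 \<le> \<delta> * t\<^sup>2" using st delta_pos by (simp add: power_mono)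
  ultimately show "g s \<le> g t" by simp
qed

lemma g_ge: "0 \<le> t \<Longrightarrow> t < 1 \<Longrightarrow> g 0 \<le> g t"
  by (rule mono_onD[OF g_mono]) auto

lemma g_nonneg: "0 \<le> t \<Longrightarrow> t < 1 \<Longrightarrow> 0 \<le> g t"
  using g_ge[of t] zero_pos by simp

text \<open>The weight exceeds the constant \<open>g 0\<close> by a nondecreasing function, and for a constant weight the real
  part in \<open>Re_exp_transform_nonneg\<close> is explicit and positive below the real axis.\<close>

lemma E_nonzero_lower:
  assumes "Im z < 0"
  shows "E z \<noteq> 0"
proof
  assume "E z = 0"
  have z: "z \<noteq> 0" using assms by auto
  have int: "integrable unit_lborel (\<lambda>t. g 0)"
    by (rule integrable_unit_lborel_bounded[where B = "\<bar>g 0\<bar>"]) auto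
  have "0 \<le> Re (\<i> * z * exp (- (\<i> * z)) * exp_transform (\<lambda>t. g t - g 0) z)"
  proof (rule Re_exp_transform_nonneg)
    show "integrable unit_lborel (\<lambda>t. g t - g 0)" using integrable int by simp
    show "mono_on {0..<1} (\<lambda>t. g t - g 0)" using g_mono by (auto simp: monotone_on_def)
  qed (use g_ge assms in auto)
  also have "exp_transform (\<lambda>t. g t - g 0) z = - (of_real (g 0) * ((exp (\<i> * z) - 1) / (\<i> * z)))"
    using exp_transform_diff[OF integrable int] \<open>E z = 0\<close> exp_transform_const[OF z] by simp
  also have "\<i> * z * exp (- (\<i> * z)) * \<dots> = of_real (g 0) * (exp (- (\<i> * z)) - 1)"
    using z by (simp add: exp_minus field_simps)
  finally have "1 \<le> Re (exp (- (\<i> * z)))" using zero_pos by (simp add: zero_le_mult_iff)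
  also have "\<dots> \<le> norm (exp (- (\<i> * z)))" by (rule complex_Re_le_cmod)
  also have "\<dots> < 1" using assms by (simp add: norm_exp_eq_Re)
  finally show False by simp
qed

text \<open>The strict inequality says that an argument of \<open>E x\<close> lies in \<open>(x - \<pi>, x)\<close>. It comes from the part
  \<open>\<delta> t\<^sup>2\<close> of the weight, whose contribution is \<open>\<delta> (1 - 2 (1 - cos x) / x\<^sup>2) / x\<close>.\<close>

lemma Re_rotated_E_pos:
  fixes x :: real
  assumes "x > 0"
  shows "0 < Re (\<i> * exp (- (\<i> * of_real x)) * E (of_real x))"
proof -
  let ?z = "complex_of_real x"
  have z: "?z \<noteq> 0" using assms by simp
  have int: "integrable unit_lborel (\<lambda>t. \<delta> * t\<^sup>2)"
    using delta_pos by (intro integrable_unit_lborel_bounded[where B = \<delta>]) (auto simp: power_le_one abs_mult mult_left_le)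
  have "0 \<le> Re (\<i> * ?z * exp (- (\<i> * ?z)) * exp_transform (\<lambda>t. g t - \<delta> * t\<^sup>2) ?z)"
  proof (rule Re_exp_transform_nonneg)
    show "integrable unit_lborel (\<lambda>t. g t - \<delta> * t\<^sup>2)" using integrable int by simp
    show "0 \<le> g t - \<delta> * t\<^sup>2" if "0 \<le> t" "t < 1" for t
      using mono_onD[OF mono_minus_square, of 0 t] that zero_pos by simp
  qed (use mono_minus_square in auto)
  also have "\<dots> = x * Re (\<i> * exp (- (\<i> * ?z)) * E ?z) - Re (\<i> * ?z * exp (- (\<i> * ?z)) * exp_transform (\<lambda>t. \<delta> * t\<^sup>2) ?z)"
  proof -
    have "\<i> * ?z * exp (- (\<i> * ?z)) * exp_transform (\<lambda>t. g t - \<delta> * t\<^sup>2) ?z =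
       of_real x * (\<i> * exp (- (\<i> * ?z)) * E ?z) - \<i> * ?z * exp (- (\<i> * ?z)) * exp_transform (\<lambda>t. \<delta> * t\<^sup>2) ?z"
      unfolding exp_transform_diff[OF integrable int] by (simp add: algebra_simps)
    then show ?thesis by (simp only: minus_complex.sel Re_complex_of_real Im_complex_of_real times_complex.sel)
  qed
  also have "\<i> * ?z * exp (- (\<i> * ?z)) * exp_transform (\<lambda>t. \<delta> * t\<^sup>2) ?z =
     of_real \<delta> * (1 + 2 * \<i> / ?z - 2 / ?z\<^sup>2 + 2 * exp (- (\<i> * ?z)) / ?z\<^sup>2)"
    unfolding exp_transform_square[OF z] exp_minus using z
    by (simp add: field_simps power2_eq_square power3_eq_cube)
  also have "Re \<dots> = \<delta> * (2 / x\<^sup>2 * (cos x - (1 - x\<^sup>2 / 2)))"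
  proof -
    have "Re (2 * \<i> / ?z) = 0" by (simp add: complex_eq_iff Re_divide)
    moreover have "Re (2 / ?z\<^sup>2) = 2 / x\<^sup>2" by (simp flip: of_real_power)
    moreover have "Re (2 * exp (- (\<i> * ?z)) / ?z\<^sup>2) = 2 * cos x / x\<^sup>2" 
      by (simp add: Re_exp flip: of_real_power)
    ultimately show ?thesis using assms by (simp add: field_simps)
  qed
  finally have "\<delta> * (2 / x\<^sup>2 * (cos x - (1 - x\<^sup>2 / 2))) \<le> x * Re (\<i> * exp (- (\<i> * ?z)) * E ?z)" by simp
  moreover have "0 < \<delta> * (2 / x\<^sup>2 * (cos x - (1 - x\<^sup>2 / 2)))"
    using one_minus_cos_less[OF assms] delta_pos assms by (intro mult_pos_pos) auto
  ultimately show ?thesis using assms by (meson less_le_trans zero_less_mult_pos)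
qed

lemma C_minus: "C (- z) = C z"
  by (simp add: cos_transform_def)

text \<open>A zero of \<open>C\<close> makes \<open>E (- z)\<close> and \<open>E z\<close> equally large, which contradicts
  \<open>norm_exp_transform_reflect_le\<close> in the lower half plane. The upper one follows because \<open>C\<close> is even.\<close>

proposition C_zeros_real:
  assumes "C z = 0"
  shows "z \<in> \<real>"
proof -
  have lower: "C z \<noteq> 0" if "Im z < 0" for z
  proof
    assume "C z = 0"
    then have "norm (E (- z)) = norm (E z)"
      unfolding cos_transform_exp[OF integrable] by (metis add_eq_0_iff divide_eq_0_iff norm_minus_cancel zero_neq_numeral)
    moreover have "exp (- Im z) * norm (E (- z)) \<le> norm (E z)"
      using that by (intro norm_exp_transform_reflect_le integrable g_nonneg g_mono) auto
    moreover have "exp (- Im z) > 1" using that by simp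
    ultimately have "exp (- Im z) \<le> 1" using E_nonzero_lower[OF that] by simp
    with \<open>exp (- Im z) > 1\<close> show False by simp
  qed
  have "Im z = 0"
    using lower[of z] lower[of "- z"] assms C_minus[of z] by (cases "Im z" "0::real" rule: linorder_cases) auto
  then show ?thesis by (simp add: complex_is_Real_iff)
qed

lemma E_minus_real: "E (- of_real x) = cnj (E (of_real x))"
  using exp_transform_cnj[of g "of_real x"] by simp

lemma C_of_real: "C (of_real x) = of_real (Re (E (of_real x)))"
  unfolding cos_transform_exp[OF integrable] E_minus_real by (simp add: complex_eq_iff)

text \<open>Where \<open>cos x = 0\<close>, the factor \<open>i exp (- i x)\<close> in \<open>Re_rotated_E_pos\<close> equals \<open>sin x\<close>, and \<open>C x\<close> is the
  real part of \<open>E x\<close>.\<close>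

lemma sin_C_pos:
  assumes "x > 0" "cos x = 0"
  shows "0 < sin x * Re (C (of_real x))"
  using Re_rotated_E_pos[OF assms(1)] assms(2) by (simp add: C_of_real Re_exp Im_exp)

lemma C_differentiable: "\<exists>D. (C has_field_derivative D) (at z)"
proof -
  obtain D1 D2 where D: "(E has_field_derivative D1) (at z)" "(E has_field_derivative D2) (at (- z))"
    using exp_transform_differentiable[OF integrable] by blast
  have "((\<lambda>z. (E z + E (- z)) / 2) has_field_derivative (D1 + D2 * (-1)) / 2) (at z)"
    using D by (auto intro!: derivative_eq_intros DERIV_chain2[of E])
  then show ?thesis unfolding cos_transform_exp[OF integrable] by blast
qed

text \<open>The value \<open>E x = i S\<close> is purely imaginary at a zero of \<open>C\<close>. The function \<open>\<Psi>\<close> below is holomorphic, and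
  for real \<open>y\<close> it equals \<open>\<bar>E (x - i y)\<bar>\<^sup>2 - exp (2 y) \<bar>E (- x + i y)\<bar>\<^sup>2\<close>. It vanishes at
  0 and is nonnegative for \<open>y \<ge> 0\<close>, so \<open>- 4 S C' - 2 S\<^sup>2 \<ge> 0\<close>. As \<open>S cos x < 0\<close> by the bound
  on the argument of \<open>E x\<close>, the signs of \<open>C'\<close> and \<open>cos x\<close> agree.\<close>

lemma C_deriv_at_zero:
  assumes x: "x > 0" "C (of_real x) = 0" and D: "(C has_field_derivative D) (at (of_real x))"
  shows "0 < Re D * cos x"
proof -
  define S where "S = Im (E (of_real x))"
  have "Re (E (of_real x)) = 0" using x(2) unfolding C_of_real by simp
  then have Ex: "E (of_real x) = \<i> * of_real S" by (simp add: S_def complex_eq_iff)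
  then have Emx: "E (- of_real x) = - \<i> * of_real S" by (simp add: E_minus_real)
  have Scos: "S * cos x < 0"
    using Re_rotated_E_pos[OF x(1)] unfolding Ex by (simp add: Re_exp Im_exp mult.commute)
  obtain D1 D2 where D12: "(E has_field_derivative D1) (at (of_real x))" "(E has_field_derivative D2) (at (- of_real x))"
    using exp_transform_differentiable[OF integrable] by blast
  have "((\<lambda>z. (E z + E (- z)) / 2) has_field_derivative (D1 + D2 * (-1)) / 2) (at (of_real x))"
    using D12 by (auto intro!: derivative_eq_intros DERIV_chain2[of E])
  then have "D = (D1 - D2) / 2"
    using D DERIV_unique unfolding cos_transform_exp[OF integrable, abs_def] by fastforce
  define \<Psi> where "\<Psi> y = E (of_real x - \<i> * y) * E (- of_real x - \<i> * y)
     - exp (2 * y) * (E (- of_real x + \<i> * y) * E (of_real x + \<i> * y))" for y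
  have "(\<Psi> has_field_derivative - 4 * of_real S * D - 2 * of_real S ^ 2) (at 0)"
  proof -
    have d: "((\<lambda>y. E (a + c * y)) has_field_derivative D' * c) (at 0)"
      if "(E has_field_derivative D') (at a)" for a c D'
      by (rule DERIV_chain2[of E]) (use that in \<open>auto intro!: derivative_eq_intros\<close>)
    show ?thesis
      unfolding \<Psi>_def
      by (rule derivative_eq_intros d[where c = "- \<i>", simplified] d[where c = \<i>] D12 refl | simp)+
         (simp add: Ex Emx \<open>D = (D1 - D2) / 2\<close> field_simps power2_eq_square)
  qed
  then have "((\<lambda>y. \<Psi> (of_real y)) has_vector_derivative - 4 * of_real S * D - 2 * of_real S ^ 2) (at 0)"
    by (intro has_vector_derivative_real_field) simp
  from bounded_linear.has_vector_derivative[OF bounded_linear_Re this]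
  have der: "((\<lambda>y. Re (\<Psi> (of_real y))) has_real_derivative - 4 * S * Re D - 2 * S\<^sup>2) (at 0)"
    by (simp add: has_real_derivative_iff_has_vector_derivative flip: of_real_power)
  have nonneg: "0 \<le> Re (\<Psi> (of_real y))" if "y \<ge> 0" for y
  proof -
    define z where "z = of_real x - \<i> * of_real y"
    have "- of_real x - \<i> * of_real y = - cnj z" "- of_real x + \<i> * of_real y = - z" "of_real x + \<i> * of_real y = - cnj (- z)"
      by (simp_all add: z_def)
    then have "\<Psi> (of_real y) = E z * cnj (E z) - exp (2 * of_real y) * (E (- z) * cnj (E (- z)))"
      unfolding \<Psi>_def z_def[symmetric] by (simp only: exp_transform_cnj)
    also have "\<dots> = of_real ((norm (E z))\<^sup>2 - (exp y * norm (E (- z)))\<^sup>2)"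
      unfolding power_mult_distrib of_real_diff of_real_mult complex_norm_square
      by (simp add: exp_double exp_of_real)
    finally have "Re (\<Psi> (of_real y)) = (norm (E z))\<^sup>2 - (exp y * norm (E (- z)))\<^sup>2" by simp
    moreover have "exp y * norm (E (- z)) \<le> norm (E z)"
      using norm_exp_transform_reflect_le[OF integrable g_nonneg g_mono, of z] that by (simp add: z_def)
    ultimately show ?thesis by (simp add: power_mono)
  qed
  have "0 \<le> - 4 * S * Re D - 2 * S\<^sup>2"
  proof (rule ccontr)
    assume "\<not> ?thesis"
    then obtain d where "d > 0" "\<And>h. 0 < h \<Longrightarrow> h < d \<Longrightarrow> Re (\<Psi> (of_real (0 + h))) < Re (\<Psi> (of_real 0))"
      using DERIV_neg_dec_right[OF der] by auto
    from this(2)[of "d / 2"] this(1) have "Re (\<Psi> (of_real (d / 2))) < Re (\<Psi> 0)" by simp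
    also have "Re (\<Psi> 0) = 0" by (simp add: \<Psi>_def)
    finally show False using nonneg[of "d / 2"] \<open>d > 0\<close> by simp
  qed
  moreover have "S\<^sup>2 > 0" using Scos by auto
  ultimately have "S * Re D < 0" by linarith
  with Scos show ?thesis by (auto simp: mult_less_0_iff zero_less_mult_iff)
qed

lemma C_zero_pos: "0 < Re (C 0)"
proof -
  have int: "integrable unit_lborel (\<lambda>t. g 0)"
    by (rule integrable_unit_lborel_bounded[where B = "\<bar>g 0\<bar>"]) auto
  have "integral\<^sup>L unit_lborel (\<lambda>t. g 0) \<le> integral\<^sup>L unit_lborel g"
    using g_ge by (intro integral_mono int integrable) auto
  also have "integral\<^sup>L unit_lborel (\<lambda>t. g 0) = g 0" by (subst integral_unit_lborel) simp
  finally show ?thesis using zero_pos integrable by (simp add: cos_transform_def)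
qed

lemma C_of_real_derivative:
  "((\<lambda>x. Re (C (of_real x))) has_real_derivative Re (deriv C (of_real x))) (at x)"
proof -
  have "(C has_field_derivative deriv C (of_real x)) (at (of_real x))"
    using C_differentiable DERIV_imp_deriv by metis
  from bounded_linear.has_vector_derivative[OF bounded_linear_Re has_vector_derivative_real_field[OF this]]
  show ?thesis by (simp add: has_real_derivative_iff_has_vector_derivative)
qed

lemma Re_C_eq_0_iff: "Re (C (of_real x)) = 0 \<longleftrightarrow> C (of_real x) = 0"
  unfolding C_of_real by simp

lemma Re_deriv_C_cos_pos:
  assumes "x > 0" "C (of_real x) = 0"
  shows "0 < Re (deriv C (of_real x)) * cos x"
  using C_deriv_at_zero[OF assms] C_differentiable DERIV_imp_deriv by metis

text \<open>A zero in the open interval would be an upward crossing because the cosine is positive there, but \<open>C\<close>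
  starts out positive at 0.\<close>

lemma C_pos_first:
  assumes "0 < x" "x \<le> pi / 2"
  shows "C (of_real x) \<noteq> 0"
proof (cases "x = pi / 2")
  case True
  then have "cos x = 0" by (simp only: cos_pi_half)
  then show ?thesis using sin_C_pos[OF assms(1)] by auto
next
  case False
  have "0 < Re (C (of_real x))"
  proof (rule stays_positive[OF C_of_real_derivative])
    fix y assume y: "0 < y" "y \<le> x" "Re (C (of_real y)) = 0"
    then have "0 < cos y" using assms False by (intro cos_gt_zero_pi) auto
    then show "0 < Re (deriv C (of_real y))"
      using Re_deriv_C_cos_pos[of y] y unfolding Re_C_eq_0_iff by (simp add: zero_less_mult_iff)
  qed (use assms C_zero_pos in auto)
  then show ?thesis by auto
qed

proposition C_zero_location:
  assumes "x > 0" "C (of_real x) = 0"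
  shows "\<exists>k::nat. x \<in> {(2 * real k + 1) * pi / 2 <..< (2 * real k + 3) * pi / 2}"
proof -
  have x: "x > pi / 2" using C_pos_first[of x] assms by force
  define k where "k = nat \<lfloor>x / pi - 1 / 2\<rfloor>"
  have "0 \<le> x / pi - 1 / 2" using x by (simp add: field_simps)
  then have "real k = of_int \<lfloor>x / pi - 1 / 2\<rfloor>" by (simp add: k_def)
  then have "real k \<le> x / pi - 1 / 2" "x / pi - 1 / 2 < real k + 1" by linarith+
  then have le: "(2 * real k + 1) * pi / 2 \<le> x" "x < (2 * real k + 3) * pi / 2"
    by (simp_all add: field_simps)
  moreover have "x \<noteq> (2 * real k + 1) * pi / 2"
  proof
    assume "x = (2 * real k + 1) * pi / 2"
    then have "cos x = 0" by (simp add: algebra_simps add_divide_distrib cos_add)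
    then show False using sin_C_pos[OF assms(1)] assms(2) by simp
  qed
  ultimately show ?thesis by (intro exI[of _ k]) simp
qed

text \<open>All zeros in the interval are crossings in the direction given by the sign of \<open>cos x\<close>, and the values
  of \<open>C\<close> at the endpoints have opposite signs.\<close>

proposition C_zero_unique:
  fixes k :: nat
  shows "\<exists>!x::real. x \<in> {(2 * real k + 1) * pi / 2 <..< (2 * real k + 3) * pi / 2} \<and> C (of_real x) = 0"
proof -
  define l u where "l = (2 * real k + 1) * pi / 2" and "u = (2 * real k + 3) * pi / 2"
  define \<sigma> :: real where "\<sigma> = (- 1) ^ Suc k"
  define c where "c x = \<sigma> * Re (C (of_real x))" for x
  have lu: "0 < l" "l < u" by (auto simp: l_def u_def field_simps intro: add_pos_nonneg)
  have der: "(c has_real_derivative \<sigma> * Re (deriv C (of_real x))) (at x)" for x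
    unfolding c_def by (intro DERIV_cmult C_of_real_derivative)
  have c0: "c x = 0 \<longleftrightarrow> C (of_real x) = 0" for x
    unfolding c_def Re_C_eq_0_iff[symmetric] by (simp add: \<sigma>_def)
  have l_eq: "l = real k * pi + pi / 2" and u_eq: "u = real (Suc k) * pi + pi / 2"
    by (simp_all add: l_def u_def field_simps)
  have "cos l = 0" "cos u = 0"
    unfolding l_eq u_eq cos_add by (simp_all add: sin_npi del: of_nat_Suc)
  then have "0 < sin l * Re (C (of_real l))" "0 < sin u * Re (C (of_real u))"
    using lu by (auto intro!: sin_C_pos)
  moreover have "sin l = - \<sigma>" "sin u = \<sigma>"
    unfolding l_eq u_eq sin_add by (simp_all add: \<sigma>_def cos_npi sin_npi del: of_nat_Suc)
  ultimately have c_lu: "c l < 0" "0 < c u" by (simp_all add: c_def)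
  have up: "0 < \<sigma> * Re (deriv C (of_real x))" if x: "l < x" "x < u" "c x = 0" for x
  proof -
    define y where "y = x - real (Suc k) * pi"
    have "- (pi / 2) < y" "y < pi / 2"
      using x unfolding y_def l_def u_def by (simp_all add: field_simps)
    then have "0 < cos y" by (intro cos_gt_zero_pi) auto
    have "cos x = cos (y + real (Suc k) * pi)" by (simp add: y_def)
    also have "\<dots> = \<sigma> * cos y" unfolding cos_add by (simp add: \<sigma>_def cos_npi sin_npi del: of_nat_Suc)
    finally have "0 < Re (deriv C (of_real x)) * (\<sigma> * cos y)"
      using Re_deriv_C_cos_pos[of x] x lu c0 by simp
    then have "0 < (\<sigma> * Re (deriv C (of_real x))) * cos y" by (simp add: mult_ac)
    then show ?thesis using \<open>0 < cos y\<close> by (simp add: zero_less_mult_iff)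
  qed
  have uniq: False if p: "l < p" "c p = 0" and q: "p < q" "q < u" "c q = 0" for p q
  proof -
    obtain d where d: "d > 0" "\<And>h. 0 < h \<Longrightarrow> h < d \<Longrightarrow> c p < c (p + h)"
      using DERIV_pos_inc_right[OF der up, of p] p q by auto
    define h where "h = min (d / 2) ((q - p) / 2)"
    have h0: "0 < h" unfolding h_def using d(1) q(1) by simp
    have "h \<le> d / 2" unfolding h_def by (rule min.cobounded1)
    also have "\<dots> < d" using d(1) by simp
    finally have hd: "h < d" .
    have "h \<le> (q - p) / 2" unfolding h_def by (rule min.cobounded2)
    also have "\<dots> < q - p" using q(1) by simp
    finally have hq: "p + h < q" by simp
    note h = h0 hd hq
    have "0 < c (p + h)" using d(2)[OF h(1,2)] p(2) by simp
    moreover have "0 < \<sigma> * Re (deriv C (of_real x))" if "p + h < x" "x \<le> q" "c x = 0" for x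
      using that h p q by (intro up) auto
    ultimately have "0 < c q"
      using h(3) by (intro stays_positive[OF der, of "p + h" q]) auto
    then show False using q by simp
  qed
  have "\<exists>x\<ge>l. x \<le> u \<and> c x = 0"
    using c_lu lu DERIV_isCont[OF der] by (intro IVT) auto
  then obtain x where x: "l < x" "x < u" "c x = 0" using c_lu by (metis less_irrefl order_le_less)
  show ?thesis
    unfolding l_def[symmetric] u_def[symmetric] c0[symmetric]
  proof (rule ex1I[of _ x])
    fix y assume "y \<in> {l<..<u} \<and> c y = 0"
    then show "y = x" using uniq[of x y] uniq[of y x] x by (cases x y rule: linorder_cases) auto
  qed (use x in auto)
qed

proposition C_zeros_simple:
  assumes "C z = 0"
  shows "deriv C z \<noteq> 0"
proof -
  obtain x where x: "z = of_real x" using C_zeros_real[OF assms] by (auto elim: Reals_cases)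
  have "x \<noteq> 0" using C_zero_pos assms x by auto
  have pos: "deriv C (of_real y) \<noteq> 0" if "y > 0" "C (of_real y) = 0" for y :: real
    using Re_deriv_C_cos_pos[OF that] by auto
  show ?thesis
  proof (cases "x > 0")
    case True
    then show ?thesis using pos assms x by simp
  next
    case False
    have "deriv C (- z) \<noteq> 0"
      using pos[of "- x"] False \<open>x \<noteq> 0\<close> assms C_minus[of z] by (simp add: x)
    moreover have "(C has_field_derivative deriv C (- z)) (at (- z))"
      using C_differentiable DERIV_imp_deriv by metis
    then have "((\<lambda>z. C (- z)) has_field_derivative deriv C (- z) * (- 1)) (at z)"
      by (intro DERIV_chain2[of C]) (auto intro!: derivative_eq_intros)
    then have "deriv C z = - deriv C (- z)" unfolding C_minus by (simp add: DERIV_imp_deriv)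
    ultimately show ?thesis by simp
  qed
qed

end

section \<open>The hypergeometric series at 1\<close>

text \<open>The coefficients of the Gauss hypergeometric series with upper parameters \<open>\<alpha>\<close>, \<open>\<beta>\<close> and lower
  parameter \<open>\<gamma>\<close>.\<close>

definition gauss_term :: "real \<Rightarrow> real \<Rightarrow> real \<Rightarrow> nat \<Rightarrow> real" where
  "gauss_term \<alpha> \<beta> \<gamma> m = pochhammer \<alpha> m * pochhammer \<beta> m / (fact m * pochhammer \<gamma> m)"

lemma gauss_term_0 [simp]: "gauss_term \<alpha> \<beta> \<gamma> 0 = 1"
  by (simp add: gauss_term_def)

lemma gauss_term_Suc:
  "gauss_term \<alpha> \<beta> \<gamma> (Suc m) =
     gauss_term \<alpha> \<beta> \<gamma> m * ((\<alpha> + real m) * (\<beta> + real m) / ((real m + 1) * (\<gamma> + real m)))"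
  by (simp add: gauss_term_def pochhammer_Suc mult_ac add.commute)

lemma gauss_term_shift:
  assumes "\<gamma> > 0"
  shows "gauss_term \<alpha> \<beta> (\<gamma> + 1) m = gauss_term \<alpha> \<beta> \<gamma> m * (\<gamma> / (\<gamma> + real m))"
proof -
  have "\<gamma> * pochhammer (\<gamma> + 1) m = pochhammer \<gamma> m * (\<gamma> + real m)"
    using pochhammer_rec[of \<gamma> m] pochhammer_Suc[of \<gamma> m] by simp
  then have "pochhammer (\<gamma> + 1) m = pochhammer \<gamma> m * (\<gamma> + real m) / \<gamma>"
    using assms by (simp add: field_simps)
  then show ?thesis by (simp add: gauss_term_def mult_ac)
qed

text \<open>The certificate behind the contiguous relation for the series at 1: the difference of the two
  summands is the forward difference of \<open>\<gamma> N T\<^sub>N\<close>.\<close>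

lemma gauss_term_telescope:
  assumes "\<gamma> > 0"
  shows "(\<gamma> - \<alpha>) * (\<gamma> - \<beta>) * (\<Sum>m<N. gauss_term \<alpha> \<beta> (\<gamma> + 1) m)
     - \<gamma> * (\<gamma> - \<alpha> - \<beta>) * (\<Sum>m<N. gauss_term \<alpha> \<beta> \<gamma> m) = \<gamma> * real N * gauss_term \<alpha> \<beta> \<gamma> N"
proof (induction N)
  case (Suc N)
  let ?T = "gauss_term \<alpha> \<beta> \<gamma> N"
  have pos: "\<gamma> + real N > 0" using assms by simp
  have "(\<gamma> - \<alpha>) * (\<gamma> - \<beta>) * gauss_term \<alpha> \<beta> (\<gamma> + 1) N - \<gamma> * (\<gamma> - \<alpha> - \<beta>) * ?T + \<gamma> * real N * ?T
     = \<gamma> * real (Suc N) * gauss_term \<alpha> \<beta> \<gamma> (Suc N)"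
    unfolding gauss_term_Suc gauss_term_shift[OF assms] using pos
    by (simp add: divide_simps) (simp add: algebra_simps)
  then show ?case using Suc by (simp add: algebra_simps)
qed simp

lemma gauss_term_neg:
  assumes "-1 < \<alpha>" "\<alpha> < 0" "0 < \<beta>" "0 < \<gamma>"
  shows "gauss_term \<alpha> \<beta> \<gamma> (Suc m) < 0"
proof (induction m)
  case 0
  then show ?case using assms by (simp add: gauss_term_Suc mult_neg_pos divide_neg_pos)
next
  case (Suc m)
  have "0 < (\<alpha> + real (Suc m)) * (\<beta> + real (Suc m)) / ((real (Suc m) + 1) * (\<gamma> + real (Suc m)))"
    using assms by (intro divide_pos_pos mult_pos_pos) auto
  with Suc show ?case unfolding gauss_term_Suc[of _ _ _ "Suc m"] by (rule mult_neg_pos)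
qed

context
  fixes \<alpha> \<beta> :: real
  assumes \<alpha>: "-1 < \<alpha>" "\<alpha> < 0" and \<beta>: "0 < \<beta>"
begin

lemma gauss_term_le_shift:
  assumes "\<gamma> > 0"
  shows "gauss_term \<alpha> \<beta> \<gamma> m \<le> gauss_term \<alpha> \<beta> (\<gamma> + 1) m"
proof (cases m)
  case (Suc n)
  then have "gauss_term \<alpha> \<beta> \<gamma> m < 0" using gauss_term_neg \<alpha> \<beta> assms by simp
  moreover have "\<gamma> / (\<gamma> + real m) \<le> 1" using assms by simp
  ultimately show ?thesis
    unfolding gauss_term_shift[OF assms]
    using mult_left_mono_neg[of "\<gamma> / (\<gamma> + real m)" 1 "gauss_term \<alpha> \<beta> \<gamma> m"] by simp
qed simp

text \<open>The telescoped right-hand side is nonpositive, and the partial sums with the larger lower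
  parameter are the larger ones; eliminating the latter leaves \<open>- \<alpha> \<beta>\<close> times the partial sum. All terms
  after the first are negative, so this bounds their total size by 1 and proves convergence.\<close>

lemma gauss_term_partial_sums_nonneg:
  assumes "\<beta> < \<gamma>"
  shows "0 \<le> (\<Sum>m<N. gauss_term \<alpha> \<beta> \<gamma> m)"
proof -
  have \<gamma>: "\<gamma> > 0" using \<beta> assms by simp
  let ?S = "\<Sum>m<N. gauss_term \<alpha> \<beta> \<gamma> m" and ?S' = "\<Sum>m<N. gauss_term \<alpha> \<beta> (\<gamma> + 1) m"
  have "real N * gauss_term \<alpha> \<beta> \<gamma> N \<le> 0"
    using gauss_term_neg[of \<alpha> \<beta> \<gamma> "N - 1"] \<alpha> \<beta> \<gamma> by (cases N) (auto simp: mult_le_0_iff)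
  then have "(\<gamma> - \<alpha>) * (\<gamma> - \<beta>) * ?S' - \<gamma> * (\<gamma> - \<alpha> - \<beta>) * ?S \<le> 0"
    unfolding gauss_term_telescope[OF \<gamma>] using \<gamma> by (simp add: mult_le_0_iff)
  moreover have "(\<gamma> - \<alpha>) * (\<gamma> - \<beta>) * ?S \<le> (\<gamma> - \<alpha>) * (\<gamma> - \<beta>) * ?S'"
    using \<alpha> assms \<gamma> by (intro mult_left_mono sum_mono gauss_term_le_shift) auto
  ultimately have "0 \<le> (- (\<alpha> * \<beta>)) * ?S" by (simp add: algebra_simps)
  moreover have "\<alpha> * \<beta> < 0" using \<alpha> \<beta> by (simp add: mult_neg_pos)
  ultimately show ?thesis using mult_neg_neg[of "\<alpha> * \<beta>" ?S] by force
qed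

lemma summable_abs_gauss_term:
  assumes "\<beta> < \<gamma>"
  shows "summable (\<lambda>m. \<bar>gauss_term \<alpha> \<beta> \<gamma> m\<bar>)"
proof -
  have "summable (\<lambda>m. - gauss_term \<alpha> \<beta> \<gamma> (Suc m))"
  proof (rule summableI_nonneg_bounded)
    show "0 \<le> - gauss_term \<alpha> \<beta> \<gamma> (Suc m)" for m
      using gauss_term_neg[of \<alpha> \<beta> \<gamma> m] \<alpha> \<beta> assms by simp
    show "(\<Sum>m<N. - gauss_term \<alpha> \<beta> \<gamma> (Suc m)) \<le> 1" for N
      using gauss_term_partial_sums_nonneg[OF assms, of "Suc N"]
      by (simp add: sum.lessThan_Suc_shift sum_negf del: sum.lessThan_Suc)
  qed
  moreover have "\<bar>gauss_term \<alpha> \<beta> \<gamma> (Suc m)\<bar> = - gauss_term \<alpha> \<beta> \<gamma> (Suc m)" for m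
    using gauss_term_neg[of \<alpha> \<beta> \<gamma> m] \<alpha> \<beta> assms by simp
  ultimately show ?thesis
    by (subst summable_Suc_iff[symmetric]) simp
qed

lemma summable_gauss_term:
  "\<beta> < \<gamma> \<Longrightarrow> summable (gauss_term \<alpha> \<beta> \<gamma>)"
  by (rule summable_rabs_cancel[OF summable_abs_gauss_term])

text \<open>The limit exists because both partial sums in the telescoped identity converge. A nonzero limit would
  make the terms comparable to those of the harmonic series.\<close>

lemma index_times_gauss_term_tendsto_0:
  assumes "\<beta> < \<gamma>"
  shows "(\<lambda>N. real N * gauss_term \<alpha> \<beta> \<gamma> N) \<longlonglongrightarrow> 0"
proof -
  have \<gamma>: "\<gamma> > 0" using \<beta> assms by simp
  define L where "L = ((\<gamma> - \<alpha>) * (\<gamma> - \<beta>) * suminf (gauss_term \<alpha> \<beta> (\<gamma> + 1))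
     - \<gamma> * (\<gamma> - \<alpha> - \<beta>) * suminf (gauss_term \<alpha> \<beta> \<gamma>)) / \<gamma>"
  have "(\<lambda>N. ((\<gamma> - \<alpha>) * (\<gamma> - \<beta>) * (\<Sum>m<N. gauss_term \<alpha> \<beta> (\<gamma> + 1) m)
     - \<gamma> * (\<gamma> - \<alpha> - \<beta>) * (\<Sum>m<N. gauss_term \<alpha> \<beta> \<gamma> m)) / \<gamma>) \<longlonglongrightarrow> L"
    unfolding L_def using assms \<gamma> by (intro tendsto_intros summable_LIMSEQ summable_gauss_term) auto
  then have lim: "(\<lambda>N. real N * gauss_term \<alpha> \<beta> \<gamma> N) \<longlonglongrightarrow> L"
    unfolding gauss_term_telescope[OF \<gamma>] using \<gamma> by (simp add: mult.assoc)
  have "L = 0"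
  proof (rule ccontr)
    assume "L \<noteq> 0"
    then have "\<forall>\<^sub>F N in sequentially. \<bar>L\<bar> / 2 < \<bar>real N * gauss_term \<alpha> \<beta> \<gamma> N\<bar>"
      by (intro order_tendstoD(1)[OF tendsto_rabs[OF lim]]) simp
    then have "\<forall>\<^sub>F N in sequentially. norm (\<bar>L\<bar> / 2 * inverse (real N)) \<le> \<bar>gauss_term \<alpha> \<beta> \<gamma> N\<bar>"
      using eventually_gt_at_top[of 0]
      by eventually_elim (simp add: abs_mult field_simps)
    from summable_comparison_test_ev[OF this summable_abs_gauss_term[OF assms]]
    have "summable (\<lambda>N. inverse (real N))" using \<open>L \<noteq> 0\<close> by (simp add: summable_cmult_iff)
    then show False using not_summable_harmonic[where 'a = real] by simp
  qed
  with lim show ?thesis by simp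
qed

text \<open>The boundary term \<open>\<gamma> N T\<^sub>N\<close> of the telescoped identity vanishes in the limit. This is the recurrence in
  \<open>\<gamma>\<close> that Gauss's value \<open>\<Gamma>(\<gamma>) \<Gamma>(\<gamma> - \<alpha> - \<beta>) / (\<Gamma>(\<gamma> - \<alpha>) \<Gamma>(\<gamma> - \<beta>))\<close> of the series satisfies; it
  is the source of the quotients of the moments in \<open>moment_Suc\<close>.\<close>

proposition gauss_sum_shift:
  assumes "\<beta> < \<gamma>"
  shows "(\<gamma> - \<alpha>) * (\<gamma> - \<beta>) * suminf (gauss_term \<alpha> \<beta> (\<gamma> + 1)) =
     \<gamma> * (\<gamma> - \<alpha> - \<beta>) * suminf (gauss_term \<alpha> \<beta> \<gamma>)"
proof -
  have \<gamma>: "\<gamma> > 0" using \<beta> assms by simp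
  have "(\<lambda>N. (\<gamma> - \<alpha>) * (\<gamma> - \<beta>) * (\<Sum>m<N. gauss_term \<alpha> \<beta> (\<gamma> + 1) m)
     - \<gamma> * (\<gamma> - \<alpha> - \<beta>) * (\<Sum>m<N. gauss_term \<alpha> \<beta> \<gamma> m)) \<longlonglongrightarrow>
     (\<gamma> - \<alpha>) * (\<gamma> - \<beta>) * suminf (gauss_term \<alpha> \<beta> (\<gamma> + 1)) - \<gamma> * (\<gamma> - \<alpha> - \<beta>) * suminf (gauss_term \<alpha> \<beta> \<gamma>)"
    using assms by (intro tendsto_intros summable_LIMSEQ summable_gauss_term) auto
  moreover have "(\<lambda>N. \<gamma> * real N * gauss_term \<alpha> \<beta> \<gamma> N) \<longlonglongrightarrow> \<gamma> * 0"
    unfolding mult.assoc by (intro tendsto_intros index_times_gauss_term_tendsto_0 assms)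
  ultimately show ?thesis
    unfolding gauss_term_telescope[OF \<gamma>] using LIMSEQ_unique by fastforce
qed

text \<open>The sum increases strictly with the lower parameter, while by \<open>gauss_sum_shift\<close> this increase is a
  positive multiple of the sum itself.\<close>

lemma gauss_sum_pos:
  assumes "\<beta> < \<gamma>"
  shows "0 < suminf (gauss_term \<alpha> \<beta> \<gamma>)"
proof -
  have \<gamma>: "\<gamma> > 0" using \<beta> assms by simp
  let ?d = "\<lambda>m. gauss_term \<alpha> \<beta> (\<gamma> + 1) m - gauss_term \<alpha> \<beta> \<gamma> m"
  have summ: "summable (gauss_term \<alpha> \<beta> \<gamma>)" "summable (gauss_term \<alpha> \<beta> (\<gamma> + 1))"
    using assms by (auto intro: summable_gauss_term)
  have "?d 1 = - (\<alpha> * \<beta> / (\<gamma> * (\<gamma> + 1)))"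
    using \<gamma> by (simp add: gauss_term_Suc field_simps)
  also have "\<dots> > 0"
    using \<alpha> \<beta> \<gamma> by (simp add: mult_neg_pos divide_neg_pos)
  finally have "0 < suminf ?d"
    using summ gauss_term_le_shift[OF \<gamma>] by (intro suminf_pos2[of _ 1] summable_diff) auto
  then have "0 < suminf (gauss_term \<alpha> \<beta> (\<gamma> + 1)) - suminf (gauss_term \<alpha> \<beta> \<gamma>)"
    using suminf_diff[OF summ(2,1)] by simp
  then have "0 < (\<gamma> - \<alpha>) * (\<gamma> - \<beta>) * (suminf (gauss_term \<alpha> \<beta> (\<gamma> + 1)) - suminf (gauss_term \<alpha> \<beta> \<gamma>))"
    using \<alpha> assms \<gamma> by simp
  also have "\<dots> = (- (\<alpha> * \<beta>)) * suminf (gauss_term \<alpha> \<beta> \<gamma>)"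
    using gauss_sum_shift[OF assms] by (simp add: algebra_simps)
  finally show ?thesis using \<alpha> \<beta> by (simp add: zero_less_mult_iff mult_neg_pos mult_less_0_iff)
qed

end

section \<open>Beta integrals in the variable \<open>t\<^sup>2\<close>\<close>

definition beta_integral :: "nat \<Rightarrow> real \<Rightarrow> real" where
  "beta_integral k \<sigma> = (\<integral>t. t ^ (2 * k) * (1 - t\<^sup>2) powr (\<sigma> - 1) \<partial>unit_lborel)"

lemma one_minus_square_pos: "0 \<le> t \<Longrightarrow> t < 1 \<Longrightarrow> 0 < 1 - (t::real)\<^sup>2"
  by (simp add: abs_square_less_1)

lemma integrable_one_minus_square_powr:
  assumes "0 < \<sigma>" "\<sigma> < 1"
  shows "integrable unit_lborel (\<lambda>t. (1 - t\<^sup>2) powr (\<sigma> - 1))"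
proof (rule Bochner_Integration.integrable_bound)
  \<comment> \<open>The factor \<open>t powr (1 - 1)\<close> is 1 except at \<open>t = 0\<close>, where it is 0.\<close>
  have "integrable lborel (\<lambda>t. indicator {0..1} t *\<^sub>R (t powr (1 - 1) * (1 - t) powr (\<sigma> - 1)))"
    using integrable_Beta[of 1 \<sigma>] assms by (simp add: set_integrable_def)
  then have "integrable lborel (\<lambda>t. indicator {0..<1} t *\<^sub>R (1 - t) powr (\<sigma> - 1))"
  proof (rule Bochner_Integration.integrable_bound)
    show "AE t in lborel. norm (indicator {0..<1} t *\<^sub>R (1 - t) powr (\<sigma> - 1)) \<le>
      norm (indicator {0..1} t *\<^sub>R (t powr (1 - 1) * (1 - t) powr (\<sigma> - 1)))"
      using AE_lborel_singleton[of "0::real"] by eventually_elim (auto simp: indicator_def)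
  qed measurable
  then show "integrable unit_lborel (\<lambda>t. (1 - t) powr (\<sigma> - 1))" by (simp add: integrable_unit_lborel)
  show "AE t in unit_lborel. norm ((1 - t\<^sup>2) powr (\<sigma> - 1)) \<le> norm ((1 - t) powr (\<sigma> - 1))"
  proof (rule AE_I2)
    fix t assume "t \<in> space unit_lborel"
    then have t: "0 \<le> t" "t < 1" by auto
    then have "t\<^sup>2 \<le> t" by (simp add: power2_eq_square mult_left_le)
    then have "(1 - t\<^sup>2) powr (\<sigma> - 1) \<le> (1 - t) powr (\<sigma> - 1)"
      using t assms by (intro powr_mono2') auto
    then show "norm ((1 - t\<^sup>2) powr (\<sigma> - 1)) \<le> norm ((1 - t) powr (\<sigma> - 1))" by simp
  qed
qed measurable

lemma integrable_beta_integral: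
  assumes "0 < \<sigma>"
  shows "integrable unit_lborel (\<lambda>t. t ^ (2 * k) * (1 - t\<^sup>2) powr (\<sigma> - 1))"
proof (rule Bochner_Integration.integrable_bound)
  \<comment> \<open>The exponent of the dominating function has to lie below 1, while \<open>\<sigma>\<close> may be large.\<close>
  define \<tau> where "\<tau> = min \<sigma> (1/2)"
  show "integrable unit_lborel (\<lambda>t. (1 - t\<^sup>2) powr (\<tau> - 1))"
    using assms by (intro integrable_one_minus_square_powr) (auto simp: \<tau>_def)
  show "AE t in unit_lborel. norm (t ^ (2 * k) * (1 - t\<^sup>2) powr (\<sigma> - 1)) \<le> norm ((1 - t\<^sup>2) powr (\<tau> - 1))"
  proof (rule AE_I2)
    fix t assume "t \<in> space unit_lborel"
    then have t: "0 \<le> t" "t < 1" by auto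
    have "t ^ (2 * k) * (1 - t\<^sup>2) powr (\<sigma> - 1) \<le> 1 * (1 - t\<^sup>2) powr (\<tau> - 1)"
      using t one_minus_square_pos[OF t] by (intro mult_mono powr_mono') (auto simp: \<tau>_def power_le_one)
    then show "norm (t ^ (2 * k) * (1 - t\<^sup>2) powr (\<sigma> - 1)) \<le> norm ((1 - t\<^sup>2) powr (\<tau> - 1))"
      using t by (simp add: abs_mult)
  qed
qed measurable

lemma powr_add_one: "0 < w \<Longrightarrow> w powr \<sigma> = w powr (\<sigma> - 1) * (w::real)"
  using powr_add[of w "\<sigma> - 1" 1] by simp

text \<open>The factor \<open>1 - t\<^sup>2\<close> is expanded. This and integration by parts (\<open>beta_integral_parts\<close>) are two
  linear relations between three neighbouring beta integrals, and so determine their quotients.\<close>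

lemma beta_integral_split:
  assumes "0 < \<sigma>"
  shows "beta_integral k (\<sigma> + 1) = beta_integral k \<sigma> - beta_integral (Suc k) \<sigma>"
proof -
  have "beta_integral k (\<sigma> + 1) =
    (\<integral>t. t ^ (2 * k) * (1 - t\<^sup>2) powr (\<sigma> - 1) - t ^ (2 * Suc k) * (1 - t\<^sup>2) powr (\<sigma> - 1) \<partial>unit_lborel)"
    unfolding beta_integral_def
  proof (intro Bochner_Integration.integral_cong refl)
    fix t assume "t \<in> space unit_lborel"
    then have eq: "(1 - t\<^sup>2) powr (\<sigma> + 1 - 1) = (1 - t\<^sup>2) powr (\<sigma> - 1) * (1 - t\<^sup>2)"
      using powr_add_one[OF one_minus_square_pos[of t], of \<sigma>] by simp
    show "t ^ (2 * k) * (1 - t\<^sup>2) powr (\<sigma> + 1 - 1) =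
      t ^ (2 * k) * (1 - t\<^sup>2) powr (\<sigma> - 1) - t ^ (2 * Suc k) * (1 - t\<^sup>2) powr (\<sigma> - 1)"
      unfolding eq by (simp add: algebra_simps power2_eq_square)
  qed
  then show ?thesis
    unfolding beta_integral_def using integrable_beta_integral[OF assms]
    by (simp only: Bochner_Integration.integral_diff)
qed

lemma beta_integral_parts:
  assumes "0 < \<sigma>"
  shows "real (2 * k + 1) * beta_integral k (\<sigma> + 1) = 2 * \<sigma> * beta_integral (Suc k) \<sigma>"
proof -
  let ?f = "\<lambda>t. real (2 * k + 1) * (t ^ (2 * k) * (1 - t\<^sup>2) powr (\<sigma> + 1 - 1)) -
      2 * \<sigma> * (t ^ (2 * Suc k) * (1 - t\<^sup>2) powr (\<sigma> - 1))"
  let ?F = "\<lambda>t::real. t ^ (2 * k + 1) * (1 - t\<^sup>2) powr \<sigma>"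
  have i1: "integrable unit_lborel (\<lambda>t. t ^ (2 * k) * (1 - t\<^sup>2) powr (\<sigma> + 1 - 1))"
    using assms by (intro integrable_beta_integral) simp
  have i2: "integrable unit_lborel (\<lambda>t. t ^ (2 * Suc k) * (1 - t\<^sup>2) powr (\<sigma> - 1))"
    using assms by (rule integrable_beta_integral)
  have "integral\<^sup>L unit_lborel ?f = ?F 1 - ?F 0"
  proof (rule integral_unit_lborel_FTC)
    show "integrable unit_lborel ?f"
      by (intro Bochner_Integration.integrable_diff integrable_mult_right i1 i2)
    show "continuous_on {0..1} ?F"
      using assms by (intro continuous_intros continuous_on_powr') (auto simp: abs_square_le_1)
    fix t :: real assume t: "0 < t" "t < 1"
    then have w: "0 < 1 - t\<^sup>2" by (intro one_minus_square_pos) auto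
    have "((\<lambda>t. t ^ (2 * k + 1)) has_real_derivative real (2 * k + 1) * t ^ (2 * k)) (at t)"
      using DERIV_pow[of "2 * k + 1" t UNIV] by simp
    moreover have "((\<lambda>t. (1 - t\<^sup>2) powr \<sigma>) has_real_derivative \<sigma> * (1 - t\<^sup>2) powr (\<sigma> - 1) * (- (2 * t))) (at t)"
      by (rule DERIV_chain2[where f = "\<lambda>w. w powr \<sigma>"], rule has_real_derivative_powr[OF w])
         (auto intro!: derivative_eq_intros)
    ultimately have "(?F has_real_derivative ?f t) (at t)"
      by (rule DERIV_cong[OF DERIV_mult]) (simp add: algebra_simps)
    then show "(?F has_vector_derivative ?f t) (at t)"
      by (simp add: has_real_derivative_iff_has_vector_derivative)
  qed
  also have "\<dots> = 0" by simp
  finally show ?thesis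
    unfolding beta_integral_def
    by (subst (asm) Bochner_Integration.integral_diff)
       (use i1 i2 in \<open>auto intro!: integrable_mult_right\<close>)
qed

lemma beta_integral_Suc:
  assumes "0 < \<sigma>"
  shows "beta_integral (Suc k) \<sigma> = beta_integral k \<sigma> * ((real k + 1/2) / (real k + 1/2 + \<sigma>))"
    and "beta_integral k (\<sigma> + 1) = beta_integral k \<sigma> * (\<sigma> / (real k + 1/2 + \<sigma>))"
proof -
  have pos: "real k + 1/2 + \<sigma> > 0" using assms by simp
  show 1: "beta_integral (Suc k) \<sigma> = beta_integral k \<sigma> * ((real k + 1/2) / (real k + 1/2 + \<sigma>))"
    using beta_integral_parts[OF assms, of k] pos unfolding beta_integral_split[OF assms]
    by (simp add: field_simps)
  show "beta_integral k (\<sigma> + 1) = beta_integral k \<sigma> * (\<sigma> / (real k + 1/2 + \<sigma>))"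
    unfolding beta_integral_split[OF assms] 1 using pos by (simp add: field_simps)
qed

lemma beta_integral_add_nat:
  assumes "0 < \<sigma>"
  shows "beta_integral k (\<sigma> + real m) =
    beta_integral k \<sigma> * (pochhammer \<sigma> m / pochhammer (real k + 1/2 + \<sigma>) m)"
proof (induction m)
  case (Suc m)
  have "beta_integral k (\<sigma> + real (Suc m)) = beta_integral k ((\<sigma> + real m) + 1)" by (simp add: add_ac)
  also have "\<dots> = beta_integral k (\<sigma> + real m) * ((\<sigma> + real m) / (real k + 1/2 + (\<sigma> + real m)))"
    using assms by (intro beta_integral_Suc) auto
  also have "\<dots> = beta_integral k \<sigma> * (pochhammer \<sigma> (Suc m) / pochhammer (real k + 1/2 + \<sigma>) (Suc m))"
    unfolding Suc pochhammer_Suc by (simp add: add_ac)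
  finally show ?case .
qed simp

section \<open>The Lommel function as a cosine transform\<close>

text \<open>Here \<open>\<alpha>\<close> and \<open>\<beta>\<close> stand for \<open>(\<mu> + 1 - \<bar>\<nu>\<bar>) / 2\<close> and \<open>(\<mu> + 1 + \<bar>\<nu>\<bar>) / 2\<close>.\<close>

locale lommel_params =
  fixes \<alpha> \<beta> :: real
  assumes \<alpha>: "- 1 / 2 < \<alpha>" "\<alpha> < 0" and \<beta>: "0 < \<beta>" and sum_less: "\<alpha> + \<beta> < 1 / 2"
begin

definition s :: real where "s = \<alpha> + \<beta> + 1 / 2"

lemma s_bounds: "0 < s" "s < 1" "\<beta> < s"
  using \<alpha> \<beta> sum_less by (auto simp: s_def)

text \<open>The hypergeometric function with upper parameters \<open>\<alpha>\<close>, \<open>\<beta>\<close> and lower parameter \<open>s\<close>.\<close>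

definition \<phi> :: "real \<Rightarrow> real" where
  "\<phi> w = (\<Sum>m. gauss_term \<alpha> \<beta> s m * w ^ m)"

definition weight :: "real \<Rightarrow> real" where
  "weight t = (1 - t\<^sup>2) powr (s - 1) * \<phi> (1 - t\<^sup>2)"

lemma abs_summable: "summable (\<lambda>m. \<bar>gauss_term \<alpha> \<beta> s m\<bar>)"
  using summable_abs_gauss_term[of \<alpha> \<beta> s] \<alpha> \<beta> s_bounds by simp

lemma summable_\<phi>:
  assumes "0 \<le> w" "w \<le> 1"
  shows "summable (\<lambda>m. gauss_term \<alpha> \<beta> s m * w ^ m)"
  using assms
  by (intro summable_comparison_test'[OF abs_summable]) (auto simp: abs_mult power_le_one mult_left_le)

text \<open>Every coefficient of the power series except the constant one is negative.\<close>

lemma \<phi>_antimono: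
  assumes "0 \<le> w" "w \<le> w'" "w' \<le> 1"
  shows "\<phi> w' \<le> \<phi> w"
  unfolding \<phi>_def
proof (intro suminf_le summable_\<phi>)
  show "gauss_term \<alpha> \<beta> s m * w' ^ m \<le> gauss_term \<alpha> \<beta> s m * w ^ m" for m
  proof (cases m)
    case (Suc n)
    then have "gauss_term \<alpha> \<beta> s m \<le> 0"
      using gauss_term_neg[of \<alpha> \<beta> s n] \<alpha> \<beta> s_bounds by simp
    then show ?thesis using assms by (intro mult_left_mono_neg power_mono)
  qed simp
qed (use assms in auto)

lemma \<phi>_0: "\<phi> 0 = 1"
  unfolding \<phi>_def by (subst suminf_finite[of "{0}"]) auto

lemma \<phi>_1_pos: "0 < \<phi> 1"
  using gauss_sum_pos[of \<alpha> \<beta> s] \<alpha> \<beta> s_bounds by (simp add: \<phi>_def)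

lemma \<phi>_bounds:
  assumes "0 \<le> w" "w \<le> 1"
  shows "\<phi> 1 \<le> \<phi> w" "\<phi> w \<le> 1" "0 < \<phi> w"
  using \<phi>_antimono[of w 1] \<phi>_antimono[of 0 w] \<phi>_1_pos \<phi>_0 assms by auto

lemma weight_measurable [measurable]: "weight \<in> borel_measurable borel"
  unfolding weight_def \<phi>_def by measurable

lemma weight_integrable: "integrable unit_lborel weight"
proof (rule Bochner_Integration.integrable_bound)
  show "integrable unit_lborel (\<lambda>t. (1 - t\<^sup>2) powr (s - 1))"
    using s_bounds by (intro integrable_one_minus_square_powr)
  show "AE t in unit_lborel. norm (weight t) \<le> norm ((1 - t\<^sup>2) powr (s - 1))"
  proof (rule AE_I2)
    fix t assume "t \<in> space unit_lborel"
    then have "0 < 1 - t\<^sup>2" using one_minus_square_pos[of t] by simp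
    then show "norm (weight t) \<le> norm ((1 - t\<^sup>2) powr (s - 1))"
      using \<phi>_bounds[of "1 - t\<^sup>2"] by (simp add: weight_def abs_mult mult_left_le)
  qed
qed measurable

text \<open>As a function of \<open>u = t\<^sup>2\<close>, the power \<open>(1 - u) powr (s - 1)\<close> has derivative at least \<open>1 - s\<close> on
  \<open>[0, 1)\<close>.\<close>

lemma powr_minus_square_mono:
  assumes "0 \<le> t" "t \<le> t'" "t' < 1"
  shows "(1 - s) * (t'\<^sup>2 - t\<^sup>2) \<le> (1 - t'\<^sup>2) powr (s - 1) - (1 - t\<^sup>2) powr (s - 1)"
proof -
  have "(1 - t\<^sup>2) powr (s - 1) - (1 - s) * t\<^sup>2 \<le> (1 - t'\<^sup>2) powr (s - 1) - (1 - s) * t'\<^sup>2"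
  proof (rule DERIV_nonneg_imp_nondecreasing[OF power_mono, where f = "\<lambda>u. (1 - u) powr (s - 1) - (1 - s) * u"])
    fix u assume u: "t\<^sup>2 \<le> u" "u \<le> t'\<^sup>2"
    then have u1: "0 \<le> u" "u < 1" using assms one_minus_square_pos[of t'] by (auto intro: order_trans[of 0 "t\<^sup>2"])
    have "((\<lambda>u. (1 - u) powr (s - 1) - (1 - s) * u) has_real_derivative (s - 1) * (1 - u) powr (s - 1 - 1) * (- 1) - (1 - s)) (at u)"
    proof (rule DERIV_diff)
      show "((\<lambda>u. (1 - u) powr (s - 1)) has_real_derivative (s - 1) * (1 - u) powr (s - 1 - 1) * - 1) (at u)"
        by (rule DERIV_chain2[where f = "\<lambda>w. w powr (s - 1)"], rule has_real_derivative_powr)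
           (use u1 in \<open>auto intro!: derivative_eq_intros\<close>)
    qed (auto intro!: derivative_eq_intros)
    moreover have "0 \<le> (s - 1) * (1 - u) powr (s - 1 - 1) * (- 1) - (1 - s)"
    proof -
      have "1 powr (s - 1 - 1) \<le> (1 - u) powr (s - 1 - 1)"
        using u1 s_bounds by (intro powr_mono2') auto
      then have "0 \<le> (1 - s) * ((1 - u) powr (s - 1 - 1) - 1)"
        using s_bounds by (intro mult_nonneg_nonneg) auto
      then show ?thesis by (simp add: algebra_simps)
    qed
    ultimately show "\<exists>y. ((\<lambda>u. (1 - u) powr (s - 1) - (1 - s) * u) has_real_derivative y) (at u) \<and> 0 \<le> y" by blast
  qed (use assms in auto)
  then show ?thesis by (simp add: algebra_simps)
qed

text \<open>The power contributes at least \<open>(1 - s) (t'\<^sup>2 - t\<^sup>2)\<close> to the increment, multiplied by a value of \<open>\<phi>\<close>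
  that is at least \<open>\<phi> 1\<close>; the growth of \<open>\<phi> (1 - t\<^sup>2)\<close> only adds to this.\<close>

lemma weight_mono: "mono_on {0..<1} (\<lambda>t. weight t - (1 - s) * \<phi> 1 * t\<^sup>2)"
proof (rule mono_onI)
  fix t t' :: real assume "t \<in> {0..<1}" "t' \<in> {0..<1}" "t \<le> t'"
  then have t: "0 \<le> t" "t \<le> t'" "t' < 1" by auto
  let ?p = "\<lambda>t::real. (1 - t\<^sup>2) powr (s - 1)"
  have sq: "t\<^sup>2 \<le> t'\<^sup>2" using t by (intro power_mono) auto
  have w: "0 < 1 - t'\<^sup>2" "1 - t'\<^sup>2 \<le> 1 - t\<^sup>2" "1 - t\<^sup>2 \<le> 1"
    using t sq one_minus_square_pos[of t'] by auto
  have p: "?p t \<le> ?p t'" using w s_bounds by (intro powr_mono2') auto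
  have "(1 - s) * \<phi> 1 * (t'\<^sup>2 - t\<^sup>2) = (1 - s) * (t'\<^sup>2 - t\<^sup>2) * \<phi> 1" by simp
  also have "\<dots> \<le> (?p t' - ?p t) * \<phi> (1 - t'\<^sup>2)"
    using powr_minus_square_mono[OF t] \<phi>_bounds[of "1 - t'\<^sup>2"] \<phi>_1_pos w p
    by (intro mult_mono) auto
  also have "\<dots> \<le> (?p t' - ?p t) * \<phi> (1 - t'\<^sup>2) + ?p t * (\<phi> (1 - t'\<^sup>2) - \<phi> (1 - t\<^sup>2))"
    using \<phi>_antimono[of "1 - t'\<^sup>2" "1 - t\<^sup>2"] w by simp
  also have "\<dots> = weight t' - weight t" by (simp add: weight_def algebra_simps)
  finally show "weight t - (1 - s) * \<phi> 1 * t\<^sup>2 \<le> weight t' - (1 - s) * \<phi> 1 * t'\<^sup>2"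
    by (simp add: algebra_simps)
qed

sublocale polya_weight weight "(1 - s) * \<phi> 1"
proof
  show "(1 - s) * \<phi> 1 > 0" using s_bounds \<phi>_1_pos by simp
  show "weight 0 > 0" using \<phi>_1_pos by (simp add: weight_def)
qed (rule weight_integrable weight_mono)+

definition moment :: "nat \<Rightarrow> real" where
  "moment k = (\<integral>t. weight t * t ^ (2 * k) \<partial>unit_lborel)"

text \<open>Termwise integration: the factor \<open>(s)\<^sub>m\<close> in the beta integrals cancels the denominators of \<open>\<phi>\<close>, and
  \<open>(k + 1/2 + s)\<^sub>m\<close> takes its place, so the lower parameter \<open>s\<close> becomes \<open>k + 1/2 + s\<close>.\<close>

lemma moment_eq: "moment k = beta_integral k s * suminf (gauss_term \<alpha> \<beta> (real k + 1/2 + s))"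
proof -
  define f where "f m t = gauss_term \<alpha> \<beta> s m * (t ^ (2 * k) * (1 - t\<^sup>2) powr (s + real m - 1))" for m t
  have int: "integrable unit_lborel (f m)" for m
    unfolding f_def using s_bounds by (intro integrable_mult_right integrable_beta_integral) auto
  have f_eq: "f m t = (gauss_term \<alpha> \<beta> s m * (1 - t\<^sup>2) ^ m) * (t ^ (2 * k) * (1 - t\<^sup>2) powr (s - 1))"
    if "0 \<le> t" "t < 1" for m t
  proof -
    have "(1 - t\<^sup>2) powr (s + real m - 1) = (1 - t\<^sup>2) powr (s - 1) * (1 - t\<^sup>2) ^ m"
      using one_minus_square_pos[OF that] powr_add[of "1 - t\<^sup>2" "s - 1" "real m"]
      by (simp add: powr_realpow algebra_simps)
    then show ?thesis by (simp add: f_def)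
  qed
  have norm_f: "norm (f m t) \<le> \<bar>gauss_term \<alpha> \<beta> s m\<bar> * (1 - t\<^sup>2) powr (s - 1)"
    if "0 \<le> t" "t < 1" for m t
  proof -
    have w: "0 \<le> 1 - t\<^sup>2" "1 - t\<^sup>2 \<le> 1" using one_minus_square_pos[OF that] by auto
    have "norm (f m t) = (\<bar>gauss_term \<alpha> \<beta> s m\<bar> * (1 - t\<^sup>2) ^ m) * (t ^ (2 * k) * (1 - t\<^sup>2) powr (s - 1))"
      unfolding f_eq[OF that] using w that by (simp add: abs_mult)
    also have "\<dots> \<le> (\<bar>gauss_term \<alpha> \<beta> s m\<bar> * 1) * (1 * (1 - t\<^sup>2) powr (s - 1))"
      using w that by (intro mult_mono) (auto simp: power_le_one)
    finally show ?thesis by simp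
  qed
  have "(\<lambda>m. integral\<^sup>L unit_lborel (f m)) sums (\<integral>t. (\<Sum>m. f m t) \<partial>unit_lborel)"
  proof (rule sums_integral)
    show "AE t in unit_lborel. summable (\<lambda>m. norm (f m t))"
    proof (rule AE_I2)
      fix t assume "t \<in> space unit_lborel"
      then show "summable (\<lambda>m. norm (f m t))"
        using norm_f by (intro summable_comparison_test'[OF summable_mult2[OF abs_summable]]) auto
    qed
    show "summable (\<lambda>m. \<integral>t. norm (f m t) \<partial>unit_lborel)"
    proof (rule summable_comparison_test'[OF summable_mult2[OF abs_summable]])
      fix m :: nat
      have "(\<integral>t. norm (f m t) \<partial>unit_lborel) \<le> (\<integral>t. \<bar>gauss_term \<alpha> \<beta> s m\<bar> * (1 - t\<^sup>2) powr (s - 1) \<partial>unit_lborel)"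
        using int norm_f s_bounds
        by (intro integral_mono integrable_norm integrable_mult_right integrable_one_minus_square_powr) auto
      then show "norm (\<integral>t. norm (f m t) \<partial>unit_lborel) \<le>
          \<bar>gauss_term \<alpha> \<beta> s m\<bar> * (\<integral>t. (1 - t\<^sup>2) powr (s - 1) \<partial>unit_lborel)"
        by (simp add: Bochner_Integration.integral_nonneg)
    qed
  qed (rule int)
  also have "(\<integral>t. (\<Sum>m. f m t) \<partial>unit_lborel) = moment k"
    unfolding moment_def
  proof (rule Bochner_Integration.integral_cong)
    fix t assume "t \<in> space unit_lborel"
    then have t: "0 \<le> t" "t < 1" by auto
    have "(\<Sum>m. f m t) = \<phi> (1 - t\<^sup>2) * (t ^ (2 * k) * (1 - t\<^sup>2) powr (s - 1))"
      unfolding f_eq[OF t] \<phi>_def using one_minus_square_pos[OF t]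
      by (intro suminf_mult2[symmetric] summable_\<phi>) auto
    then show "(\<Sum>m. f m t) = weight t * t ^ (2 * k)" by (simp add: weight_def)
  qed simp
  also have "(\<lambda>m. integral\<^sup>L unit_lborel (f m)) =
    (\<lambda>m. beta_integral k s * gauss_term \<alpha> \<beta> (real k + 1/2 + s) m)"
  proof
    fix m
    have "integral\<^sup>L unit_lborel (f m) = gauss_term \<alpha> \<beta> s m * beta_integral k (s + real m)"
      unfolding f_def beta_integral_def by simp
    also have "\<dots> = beta_integral k s * (gauss_term \<alpha> \<beta> s m * pochhammer s m / pochhammer (real k + 1/2 + s) m)"
      unfolding beta_integral_add_nat[OF s_bounds(1)] by simp
    also have "gauss_term \<alpha> \<beta> s m * pochhammer s m = pochhammer \<alpha> m * pochhammer \<beta> m / fact m"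
      using pochhammer_pos[of s m] s_bounds by (simp add: gauss_term_def)
    finally show "integral\<^sup>L unit_lborel (f m) = beta_integral k s * gauss_term \<alpha> \<beta> (real k + 1/2 + s) m"
      by (simp add: gauss_term_def)
  qed
  finally have "(\<lambda>m. beta_integral k s * gauss_term \<alpha> \<beta> (real k + 1/2 + s) m) sums moment k" .
  moreover have "(\<lambda>m. beta_integral k s * gauss_term \<alpha> \<beta> (real k + 1/2 + s) m) sums
     (beta_integral k s * suminf (gauss_term \<alpha> \<beta> (real k + 1/2 + s)))"
    using \<alpha> \<beta> s_bounds by (intro sums_mult summable_sums summable_gauss_term) auto
  ultimately show ?thesis by (rule sums_unique2)
qed

lemma moment_Suc:
  "moment (Suc k) = moment k * ((real k + 1/2) * (real k + 1) / ((\<alpha> + real k + 1) * (\<beta> + real k + 1)))"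
proof -
  define \<gamma> where "\<gamma> = real k + 1/2 + s"
  have \<gamma>: "\<beta> < \<gamma>" "0 < \<gamma>" "\<gamma> - \<alpha> = \<beta> + real k + 1" "\<gamma> - \<beta> = \<alpha> + real k + 1" "\<gamma> - \<alpha> - \<beta> = real k + 1"
    using s_bounds by (auto simp: \<gamma>_def s_def)
  have pos: "\<alpha> + real k + 1 > 0" "\<beta> + real k + 1 > 0" using \<alpha> \<beta> by auto
  have "(\<beta> + real k + 1) * (\<alpha> + real k + 1) * suminf (gauss_term \<alpha> \<beta> (\<gamma> + 1)) =
      \<gamma> * (real k + 1) * suminf (gauss_term \<alpha> \<beta> \<gamma>)"
    using gauss_sum_shift[of \<alpha> \<beta> \<gamma>] \<alpha> \<beta> \<gamma> by simp
  then have G: "suminf (gauss_term \<alpha> \<beta> (\<gamma> + 1)) =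
      \<gamma> * (real k + 1) * suminf (gauss_term \<alpha> \<beta> \<gamma>) / ((\<beta> + real k + 1) * (\<alpha> + real k + 1))"
    using pos by (subst nonzero_eq_divide_eq) (simp_all add: mult_ac)
  have "real (Suc k) + 1/2 + s = \<gamma> + 1" by (simp add: \<gamma>_def)
  then have "moment (Suc k) = beta_integral k s * ((real k + 1/2) / \<gamma>) * suminf (gauss_term \<alpha> \<beta> (\<gamma> + 1))"
    unfolding moment_eq beta_integral_Suc(1)[OF s_bounds(1)] \<gamma>_def[symmetric] by simp
  also have "\<dots> = moment k * ((real k + 1/2) * (real k + 1) / ((\<alpha> + real k + 1) * (\<beta> + real k + 1)))"
    unfolding G moment_eq \<gamma>_def[symmetric] using \<gamma>(2) by (simp add: mult_ac)
  finally show ?thesis .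
qed

lemma cos_transform_weight_sums:
  "(\<lambda>k. (- 1) ^ k * of_real (moment k) * z ^ (2 * k) / fact (2 * k)) sums C z"
proof -
  define a :: "nat \<Rightarrow> complex" where "a k = of_real (\<integral>t. weight t * t ^ k \<partial>unit_lborel) / fact k" for k
  have "(\<lambda>k. (a k * (\<i> * z) ^ k + a k * (\<i> * - z) ^ k) / 2) sums C z"
    unfolding cos_transform_exp[OF integrable] a_def
    using exp_transform_sums[OF integrable, of z] exp_transform_sums[OF integrable, of "- z"]
    by (intro sums_divide sums_add) simp_all
  then have "(\<lambda>k. (a (2 * k) * (\<i> * z) ^ (2 * k) + a (2 * k) * (\<i> * - z) ^ (2 * k)) / 2) sums C z"
  proof (subst sums_mono_reindex[of "\<lambda>k. 2 * k"])
    fix n assume "n \<notin> range (\<lambda>k::nat. 2 * k)"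
    then have "odd n" by (auto elim!: evenE)
    then show "(a n * (\<i> * z) ^ n + a n * (\<i> * - z) ^ n) / 2 = 0"
      by (simp add: power_minus_odd)
  qed (auto simp: strict_mono_def)
  moreover have "(a (2 * k) * (\<i> * z) ^ (2 * k) + a (2 * k) * (\<i> * - z) ^ (2 * k)) / 2 =
      (- 1) ^ k * of_real (moment k) * z ^ (2 * k) / fact (2 * k)" for k
  proof -
    have "(\<i> * w) ^ (2 * k) = (- 1) ^ k * w ^ (2 * k)" for w
      by (simp add: power_mult power_mult_distrib power_minus[of "w\<^sup>2" k])
    then show ?thesis by (simp add: a_def moment_def)
  qed
  ultimately show ?thesis by simp
qed

lemma moment_0_pos: "0 < moment 0"
  using C_zero_pos integrable by (simp add: cos_transform_def moment_def)

text \<open>Passing from \<open>k\<close> to \<open>k + 1\<close> multiplies the product by \<open>4 (\<alpha> + k + 1) (\<beta> + k + 1)\<close>, while the moments and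
  the factorials contribute exactly the reciprocal.\<close>

lemma lommel_coefficient:
  "(\<Prod>j\<le>k. 4 * (\<alpha> + real j) * (\<beta> + real j)) * (moment k / fact (2 * k)) = 4 * \<alpha> * \<beta> * moment 0"
proof (induction k)
  case (Suc k)
  have pos: "\<alpha> + real k + 1 > 0" "\<beta> + real k + 1 > 0" using \<alpha> \<beta> by auto
  have "4 * (\<alpha> + real (Suc k)) * (\<beta> + real (Suc k)) * (moment (Suc k) / fact (2 * Suc k)) = moment k / fact (2 * k)"
    unfolding moment_Suc using pos by (simp add: divide_simps) (simp add: algebra_simps)
  moreover have "(\<Prod>j\<le>Suc k. 4 * (\<alpha> + real j) * (\<beta> + real j)) * (moment (Suc k) / fact (2 * Suc k)) =
      (\<Prod>j\<le>k. 4 * (\<alpha> + real j) * (\<beta> + real j)) *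
      (4 * (\<alpha> + real (Suc k)) * (\<beta> + real (Suc k)) * (moment (Suc k) / fact (2 * Suc k)))"
    by (simp only: prod.atMost_Suc mult_ac)
  ultimately show ?case using Suc by simp
qed simp

lemma lommel_coefficient_inverse:
  "inverse (\<Prod>j\<le>k. 4 * (\<alpha> + real j) * (\<beta> + real j)) =
     moment k / fact (2 * k) / (4 * \<alpha> * \<beta> * moment 0)"
proof -
  have "4 * \<alpha> * \<beta> * moment 0 \<noteq> 0" using \<alpha> \<beta> moment_0_pos by simp
  moreover from this have "(\<Prod>j\<le>k. 4 * (\<alpha> + real j) * (\<beta> + real j)) \<noteq> 0"
    using lommel_coefficient[of k] by (metis mult_zero_left)
  ultimately show ?thesis
    using lommel_coefficient[of k] by (simp add: field_simps del: prod_zero_iff)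
qed

proposition lommel_series_eq_cos_transform:
  fixes \<mu> \<nu> :: complex
  assumes "\<mu> + 1 = of_real (\<alpha> + \<beta>)" and "\<nu>\<^sup>2 = of_real ((\<alpha> - \<beta>)\<^sup>2)"
  shows "lommel_series \<mu> \<nu> z = C z / of_real (4 * \<alpha> * \<beta> * moment 0)"
proof -
  have factor: "(\<mu> + 2 * of_nat j + 1)\<^sup>2 - \<nu>\<^sup>2 = of_real (4 * (\<alpha> + real j) * (\<beta> + real j))" for j
  proof -
    have eq: "\<mu> + 2 * of_nat j + 1 = of_real (\<alpha> + \<beta> + 2 * real j)"
      using assms(1) by (simp add: algebra_simps)
    show ?thesis
      unfolding eq assms(2) of_real_power[symmetric] of_real_diff[symmetric] of_real_eq_iff
      by (simp add: algebra_simps power2_eq_square)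
  qed
  have coeff: "(- 1) ^ k * z ^ (2 * k) / (\<Prod>j\<le>k. (\<mu> + 2 * of_nat j + 1)\<^sup>2 - \<nu>\<^sup>2) =
    (- 1) ^ k * of_real (moment k) * z ^ (2 * k) / fact (2 * k) / of_real (4 * \<alpha> * \<beta> * moment 0)" for k
  proof -
    have "inverse (\<Prod>j\<le>k. (\<mu> + 2 * of_nat j + 1)\<^sup>2 - \<nu>\<^sup>2) =
        of_real (inverse (\<Prod>j\<le>k. 4 * (\<alpha> + real j) * (\<beta> + real j)))"
      unfolding factor of_real_prod[symmetric] of_real_inverse ..
    also have "\<dots> = of_real (moment k) / fact (2 * k) / of_real (4 * \<alpha> * \<beta> * moment 0)"
      unfolding lommel_coefficient_inverse by simp
    finally show ?thesis unfolding divide_inverse[of "(- 1) ^ k * z ^ (2 * k)"] by (simp add: mult_ac)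
  qed
  show ?thesis
    unfolding lommel_series_def coeff
    by (intro sums_unique[symmetric] sums_divide cos_transform_weight_sums)
qed

end

section \<open>Zeros of the Lommel function\<close>

theorem corollary3p9:
  fixes \<mu> \<nu> :: real
  assumes "\<mu> \<in> {-3/2 <..< -1/2}"
    and "\<bar>\<nu>\<bar> \<in> {\<bar>\<mu> + 1\<bar> <..< \<mu> + 2}"
  shows "(\<forall>z. z \<noteq> 0 \<longrightarrow> lommel_s (of_real \<mu>) (of_real \<nu>) z = 0 \<longrightarrow> z \<in> \<real>)
    \<and> (\<forall>S L z. log_branch_on S L \<longrightarrow> z \<in> S \<longrightarrow>
          lommel_s_branch L (of_real \<mu>) (of_real \<nu>) z = 0 \<longrightarrow>
          z \<in> \<real> \<and> zorder (lommel_s_branch L (of_real \<mu>) (of_real \<nu>)) z = 1)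
    \<and> (\<forall>x::real. x > 0 \<longrightarrow> lommel_s (of_real \<mu>) (of_real \<nu>) (of_real x) = 0 \<longrightarrow>
          (\<exists>k::nat. x \<in> {(2 * real k + 1) * pi / 2 <..< (2 * real k + 3) * pi / 2}))
    \<and> (\<forall>k::nat. \<exists>!x::real. x \<in> {(2 * real k + 1) * pi / 2 <..< (2 * real k + 3) * pi / 2} \<and>
          lommel_s (of_real \<mu>) (of_real \<nu>) (of_real x) = 0)"
proof -
  define \<alpha> \<beta> where "\<alpha> = (\<mu> + 1 - \<bar>\<nu>\<bar>) / 2" and "\<beta> = (\<mu> + 1 + \<bar>\<nu>\<bar>) / 2"
  have sum: "\<alpha> + \<beta> = \<mu> + 1" by (simp add: \<alpha>_def \<beta>_def field_simps)
  interpret lommel_params \<alpha> \<beta>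
    using assms by unfold_locales (auto simp: sum, auto simp: \<alpha>_def \<beta>_def)
  define c where "c = 1 / complex_of_real (4 * \<alpha> * \<beta> * moment 0)"
  have c: "c \<noteq> 0" using \<alpha> \<beta> moment_0_pos by (simp add: c_def)
  have series: "lommel_series (of_real \<mu>) (of_real \<nu>) z = c * C z" for z
  proof -
    have "complex_of_real \<mu> + 1 = of_real (\<alpha> + \<beta>)" by (simp add: sum)
    moreover have "(complex_of_real \<nu>)\<^sup>2 = of_real ((\<alpha> - \<beta>)\<^sup>2)"
    proof -
      have "(\<alpha> - \<beta>)\<^sup>2 = \<nu>\<^sup>2" by (simp add: \<alpha>_def \<beta>_def field_simps power2_eq_square)
      then show ?thesis by simp
    qed
    ultimately show ?thesis by (simp add: lommel_series_eq_cos_transform c_def)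
  qed
  have s_zero: "lommel_s (of_real \<mu>) (of_real \<nu>) z = 0 \<longleftrightarrow> C z = 0" if "z \<noteq> 0" for z
    using that c by (simp add: lommel_s_def series)
  have branch: "z \<in> \<real> \<and> zorder (lommel_s_branch L (of_real \<mu>) (of_real \<nu>)) z = 1"
    if L: "log_branch_on S L" and z: "z \<in> S" and zero: "lommel_s_branch L (of_real \<mu>) (of_real \<nu>) z = 0"
    for S L z
  proof
    let ?f = "lommel_s_branch L (of_real \<mu>) (of_real \<nu>)"
    let ?e = "\<lambda>w. exp ((of_real \<mu> + 1) * L w) * c"
    have f: "?f = (\<lambda>w. ?e w * C w)" by (simp add: lommel_s_branch_def series fun_eq_iff)
    have Cz: "C z = 0" using zero c unfolding f by simp
    then show "z \<in> \<real>" by (rule C_zeros_real)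
    have S: "open S" "L holomorphic_on S" using L by (auto simp: log_branch_on_def)
    have e_hol: "?e holomorphic_on S" using S by (intro holomorphic_intros)
    have C_hol: "C holomorphic_on S"
      using C_differentiable S by (auto simp: holomorphic_on_open)
    have "(?e has_field_derivative deriv ?e z) (at z)" "(C has_field_derivative deriv C z) (at z)"
      using e_hol C_hol S z holomorphic_derivI by blast+
    then have "(?f has_field_derivative deriv ?e z * C z + deriv C z * ?e z) (at z)"
      unfolding f by (rule DERIV_mult)
    then have "deriv ?f z = deriv C z * ?e z" using Cz by (simp add: DERIV_imp_deriv)
    then have "deriv ?f z \<noteq> 0" using C_zeros_simple[OF Cz] c by simp
    moreover have "?f holomorphic_on S" unfolding f by (intro holomorphic_on_mult e_hol C_hol)
    ultimately show "zorder ?f z = 1"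
      using S z zero by (intro zorder_zero_eqI[of ?f S]) auto
  qed
  have unique: "\<exists>!x::real. x \<in> {(2 * real k + 1) * pi / 2 <..< (2 * real k + 3) * pi / 2} \<and>
          lommel_s (of_real \<mu>) (of_real \<nu>) (of_real x) = 0" for k
  proof -
    have "lommel_s (of_real \<mu>) (of_real \<nu>) (of_real x) = 0 \<longleftrightarrow> C (of_real x) = 0"
      if "x \<in> {(2 * real k + 1) * pi / 2 <..< (2 * real k + 3) * pi / 2}" for x
    proof -
      have "0 < (2 * real k + 1) * pi / 2" by simp
      then have "x > 0" using that unfolding greaterThanLessThan_iff by (meson less_trans)
      then show ?thesis by (intro s_zero) auto
    qed
    then show ?thesis using C_zero_unique[of k] by (simp cong: conj_cong)
  qed
  show ?thesis
    using C_zeros_real C_zero_location s_zero branch unique by (intro conjI allI impI) auto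
qed

end
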